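(* There exist a bounded B-regular domain $\Omega\subset\mathbb{C}^2$ and a positive, continuous, unbounded, tame pluriharmonic function $W$ on $\Omega$ such that the function $$V(z)=\sup\{u(z): u \text{ plurisubharmonic on }\Omega,\ u\le W \text{ on }\Omega,\ \sup_\Omega u<+\infty\},\qquad z\in\Omega,$$ is not upper semicontinuous. More precisely, $\Omega$ and $W$ can be chosen so that there is an analytic disc $H\subset\Omega$ with $$V=W\ \text{ on }\Omega\setminus H,\qquad V=0<W\ \text{ on }H.$$ In particular, $V^*=W$. For this same $\Omega$, $W$ and $H$, the same conclusion holds if $V$ is defined using only those plurisubharmonic $u\le W$ that are bounded both above and below on $\Omega$. Moreover, $W$ is pluri-quasibounded: it admits a positive plurisuperharmonic strong majorant.
   Context: Plurisubharmonic functions take values in $[-\infty,+\infty)$, and the constant $-\infty$ is allowed. A function $G$ with values in $(-\infty,+\infty]$ is plurisuperharmonic if $-G$ is plurisubharmonic. $V^*(z)=\limsup_{y\to z}V(y)$ (with $y=z$ included) is the upper semicontinuous regularization of $V$. An analytic disc is the image of a nonconstant holomorphic map from the open unit disc $\mathbb{D}\subset\mathbb{C}$. B-regular: a bounded domain $\Omega\subset\mathbb{C}^n$ is B-regular if every continuous real-valued function on $\partial\Omega$ extends to a continuous function on $\overline\Omega$ that is plurisubharmonic on $\Omega$. (By a theorem of Sibony this is equivalent to every boundary point $p$ admitting a strong plurisubharmonic barrier, i.e. a plurisubharmonic function $b$ on $\Omega$, continuous on $\overline\Omega$, with $b(p)=0$ and $b<0$ on $\overline\Omega\setminus\{p\}$.)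 Tame: a nonnegative plurisubharmonic function $W$ on $\Omega$ is tame if there is a nondecreasing function $\varphi\colon[0,\infty)\to[0,\infty)$ with $\varphi(t)/t\to+\infty$ as $t\to+\infty$ such that $\varphi\circ W$ has a plurisuperharmonic majorant on $\Omega$ that is not identically $+\infty$ (for instance, it suffices that $W^2$ has such a majorant). Strong majorant: a positive plurisuperharmonic function $G\not\equiv+\infty$ on $\Omega$ is a strong majorant of $W$ if for every $\varepsilon>0$ there is a constant $M_\varepsilon$ such that $W\le\varepsilon G+M_\varepsilon$ on $\Omega$; for $W>0$ this expresses that $G/W\to+\infty$ as $W\to+\infty$. The function $W$ is pluri-quasibounded if it admits such a $G$. *)

theory Defs
  imports "HOL-Analysis.Analysis"
begin

section \<open>Semicontinuity\<close>

definition usc_on :: "'a::topological_space set \<Rightarrow> ('a \<Rightarrow> ereal) \<Rightarrow> bool" where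
  "usc_on S u \<longleftrightarrow> (\<forall>c. openin (top_of_set S) {z \<in> S. u z < c})"

text \<open>Unlike \<open>at z\<close>, the filter below does not exclude the point \<open>z\<close> itself.\<close>

definition usc_reg :: "'a::topological_space set \<Rightarrow> ('a \<Rightarrow> ereal) \<Rightarrow> 'a \<Rightarrow> ereal" where
  "usc_reg S u z = Limsup (inf (nhds z) (principal S)) u"

section \<open>Subharmonic and plurisubharmonic functions\<close>

text \<open>
  The mean of \<open>u\<close> over the circle of centre \<open>c\<close> and radius \<open>r\<close>, as the integral of the positive
  part minus the integral of the negative part (\<open>e2ennreal\<close> sends negative numbers to \<open>0\<close>).
  If \<open>u < \<infinity>\<close> is upper semicontinuous on the circle, then it is bounded above there, so the first
  integral is finite and the difference is the usual integral with values in \<open>[-\<infinity>, \<infinity>)\<close>.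
\<close>

definition circle_mean :: "(complex \<Rightarrow> ereal) \<Rightarrow> complex \<Rightarrow> real \<Rightarrow> ereal" where
  "circle_mean u c r =
     (enn2ereal (\<integral>\<^sup>+ t\<in>{0..2 * pi}. e2ennreal (u (c + of_real r * cis t)) \<partial>lborel)
      - enn2ereal (\<integral>\<^sup>+ t\<in>{0..2 * pi}. e2ennreal (- u (c + of_real r * cis t)) \<partial>lborel))
     / ereal (2 * pi)"

text \<open>The function that is constantly \<open>-\<infinity>\<close> is allowed.\<close>

definition subharmonic_on :: "complex set \<Rightarrow> (complex \<Rightarrow> ereal) \<Rightarrow> bool" where
  "subharmonic_on S u \<longleftrightarrow>
     usc_on S u \<and> (\<forall>z\<in>S. u z < \<infinity>) \<and>
     (\<forall>c r. 0 < r \<and> cball c r \<subseteq> S \<longrightarrow> u c \<le> circle_mean u c r)"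

text \<open>
  Scalar multiplication \<open>*s\<close> is the complex one, so \<open>l \<mapsto> a + l *s w\<close> parametrizes a complex line
  (or a point, if \<open>w = 0\<close>).
\<close>

definition psh_on :: "(complex^'n) set \<Rightarrow> (complex^'n \<Rightarrow> ereal) \<Rightarrow> bool" where
  "psh_on \<Omega> u \<longleftrightarrow>
     usc_on \<Omega> u \<and> (\<forall>z\<in>\<Omega>. u z < \<infinity>) \<and>
     (\<forall>a w. subharmonic_on {l. a + l *s w \<in> \<Omega>} (\<lambda>l. u (a + l *s w)))"

definition psuperh_on :: "(complex^'n) set \<Rightarrow> (complex^'n \<Rightarrow> ereal) \<Rightarrow> bool" where
  "psuperh_on \<Omega> G \<longleftrightarrow> psh_on \<Omega> (\<lambda>z. - G z)"

text \<open>
  Pluriharmonic functions on an open set: twice continuously (real) differentiable, with vanishing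
  Laplacian along every complex line. Here \<open>D\<close> and \<open>D2\<close> are the first and second Frechet
  derivatives, and \<open>D2 z w w + D2 z (\<i> *s w) (\<i> *s w)\<close> is the Laplacian at \<open>l = 0\<close> of
  \<open>l \<mapsto> W (z + l *s w)\<close>.
\<close>

definition pluriharmonic_on :: "(complex^'n) set \<Rightarrow> (complex^'n \<Rightarrow> real) \<Rightarrow> bool" where
  "pluriharmonic_on \<Omega> W \<longleftrightarrow>
     (\<exists>(D :: complex^'n \<Rightarrow> (complex^'n) \<Rightarrow>\<^sub>L real)
       (D2 :: complex^'n \<Rightarrow> (complex^'n) \<Rightarrow>\<^sub>L ((complex^'n) \<Rightarrow>\<^sub>L real)).
        (\<forall>z\<in>\<Omega>. (W has_derivative blinfun_apply (D z)) (at z)) \<and>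
        (\<forall>z\<in>\<Omega>. (D has_derivative blinfun_apply (D2 z)) (at z)) \<and>
        continuous_on \<Omega> D2 \<and>
        (\<forall>z\<in>\<Omega>. \<forall>w.
           blinfun_apply (blinfun_apply (D2 z) w) w +
           blinfun_apply (blinfun_apply (D2 z) (\<i> *s w)) (\<i> *s w) = 0))"

section \<open>Domains and analytic discs\<close>

definition bounded_domain :: "(complex^'n) set \<Rightarrow> bool" where
  "bounded_domain \<Omega> \<longleftrightarrow> open \<Omega> \<and> connected \<Omega> \<and> \<Omega> \<noteq> {} \<and> bounded \<Omega>"

definition B_regular :: "(complex^'n) set \<Rightarrow> bool" where
  "B_regular \<Omega> \<longleftrightarrow>
     bounded_domain \<Omega> \<and>
     (\<forall>f :: complex^'n \<Rightarrow> real. continuous_on (frontier \<Omega>) f \<longrightarrow>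
        (\<exists>F :: complex^'n \<Rightarrow> real.
           continuous_on (closure \<Omega>) F \<and> (\<forall>z\<in>frontier \<Omega>. F z = f z) \<and>
           psh_on \<Omega> (\<lambda>z. ereal (F z))))"

definition analytic_disc :: "(complex^'n) set \<Rightarrow> bool" where
  "analytic_disc H \<longleftrightarrow>
     (\<exists>h :: complex \<Rightarrow> complex^'n.
        (\<forall>i. (\<lambda>\<zeta>. h \<zeta> $ i) holomorphic_on ball 0 1) \<and>
        \<not> h constant_on ball 0 1 \<and> H = h ` ball 0 1)"

section \<open>Majorants and envelopes\<close>

definition tame :: "(complex^'n) set \<Rightarrow> (complex^'n \<Rightarrow> real) \<Rightarrow> bool" where
  "tame \<Omega> W \<longleftrightarrow>
     psh_on \<Omega> (\<lambda>z. ereal (W z)) \<and> (\<forall>z\<in>\<Omega>. 0 \<le> W z) \<and>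
     (\<exists>\<phi> :: real \<Rightarrow> real.
        mono_on {0..} \<phi> \<and> (\<forall>t\<ge>0. 0 \<le> \<phi> t) \<and>
        filterlim (\<lambda>t. \<phi> t / t) at_top at_top \<and>
        (\<exists>G. psuperh_on \<Omega> G \<and> (\<exists>z\<in>\<Omega>. G z \<noteq> \<infinity>) \<and> (\<forall>z\<in>\<Omega>. ereal (\<phi> (W z)) \<le> G z)))"

definition strong_majorant ::
    "(complex^'n) set \<Rightarrow> (complex^'n \<Rightarrow> real) \<Rightarrow> (complex^'n \<Rightarrow> ereal) \<Rightarrow> bool" where
  "strong_majorant \<Omega> W G \<longleftrightarrow>
     psuperh_on \<Omega> G \<and> (\<forall>z\<in>\<Omega>. 0 < G z) \<and> (\<exists>z\<in>\<Omega>. G z \<noteq> \<infinity>) \<and>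
     (\<forall>\<epsilon>::real. 0 < \<epsilon> \<longrightarrow>
        (\<exists>M::real. \<forall>z\<in>\<Omega>. ereal (W z) \<le> ereal \<epsilon> * G z + ereal M))"

definition pluri_quasibounded :: "(complex^'n) set \<Rightarrow> (complex^'n \<Rightarrow> real) \<Rightarrow> bool" where
  "pluri_quasibounded \<Omega> W \<longleftrightarrow> (\<exists>G. strong_majorant \<Omega> W G)"

definition envelope_above :: "(complex^'n) set \<Rightarrow> (complex^'n \<Rightarrow> real) \<Rightarrow> complex^'n \<Rightarrow> ereal" where
  "envelope_above \<Omega> W z =
     (SUP u \<in> {u. psh_on \<Omega> u \<and> (\<forall>\<zeta>\<in>\<Omega>. u \<zeta> \<le> ereal (W \<zeta>)) \<and> (SUP \<zeta>\<in>\<Omega>. u \<zeta>) < \<infinity>}. u z)"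

definition envelope_bounded :: "(complex^'n) set \<Rightarrow> (complex^'n \<Rightarrow> real) \<Rightarrow> complex^'n \<Rightarrow> ereal" where
  "envelope_bounded \<Omega> W z =
     (SUP u \<in> {u. psh_on \<Omega> u \<and> (\<forall>\<zeta>\<in>\<Omega>. u \<zeta> \<le> ereal (W \<zeta>)) \<and>
                  (SUP \<zeta>\<in>\<Omega>. u \<zeta>) < \<infinity> \<and> - \<infinity> < (INF \<zeta>\<in>\<Omega>. u \<zeta>)}. u z)"

end

theory Submission
  imports Defs "HOL-Complex_Analysis.Cauchy_Integral_Formula"
begin

text \<open>
Write \<open>(z, w)\<close> for the points of the plane and \<open>P(w) = Re ((1 + w) / (1 - w))\<close> for the Poisson kernel of
the unit disc with pole at \<open>1\<close>. The function \<open>W(z, w) = P(w)\<close> is positive and pluriharmonic, and the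
domain is a Hartogs domain around the disc \<open>H = {z = 0, |w| < 1}\<close>,
\<open>\<Omega> = {|w| < 1, |z|\<^sup>2 (1 + exp (P(w)\<^sup>2)) + |w|\<^sup>2 < 1}\<close>.

On \<open>H\<close> the function \<open>W\<close> is a singular positive harmonic function: its boundary values vanish
away from one point, so a subharmonic function on the disc that is bounded above and lies below \<open>P\<close> is at
most \<open>0\<close> (lemma \<open>subharmonic_below_poisson_kernel_nonpos\<close>). Hence the envelopes are \<open>0\<close> on \<open>H\<close>.

Off \<open>H\<close> the cusp of \<open>\<Omega>\<close> at the pole helps. On \<open>\<Omega>\<close> one has \<open>W\<^sup>2 < G\<close> for the plurisuperharmonic function
\<open>G = - 2 ln |z|\<close>, which is infinite exactly on \<open>H\<close>. So \<open>W\<close> is tame with \<open>\<phi>(t) = t\<^sup>2\<close>, and \<open>G\<close> is a strong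
majorant since \<open>W \<le> \<epsilon> W\<^sup>2 + 1 / (4 \<epsilon>)\<close>. For the same reason \<open>max (W + \<epsilon> ln |z|) 0\<close> is a bounded
plurisubharmonic minorant of \<open>W\<close> (lemma \<open>psh_on_competitor\<close>), and as \<open>\<epsilon>\<close> tends to \<open>0\<close> these minorants tend to
\<open>W\<close> off \<open>H\<close>. Since \<open>H\<close> has empty interior and \<open>W\<close> is continuous, the regularized envelope is \<open>W\<close>.

For B-regularity let \<open>\<rho> = |z|\<^sup>2 (1 + exp (P\<^sup>2)) + |w|\<^sup>2 - 1\<close>. On the closure of \<open>\<Omega>\<close> it extends continuously by \<open>0\<close> to
the points over the unit circle, as \<open>|w|\<^sup>2 - 1 \<le> \<rho> \<le> 0\<close>, and \<open>\<rho>\<close> minus the squared norm is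
\<open>|z|\<^sup>2 exp (P\<^sup>2) - 1\<close>, which is plurisubharmonic because \<open>exp (P\<^sup>2)\<close> is a supremum of moduli of holomorphic
functions of \<open>w\<close> (lemma \<open>psh_on_square_exp_square\<close>). A strictly plurisubharmonic defining function of this
kind suffices: continuous boundary data are attained by a supremum of paraboloids, each corrected by
a multiple of \<open>\<rho>\<close> (lemmas \<open>continuous_on_supremum_of_barriers\<close> and \<open>B_regular_if_strict_psh_exhaustion\<close>).

The pole of \<open>G\<close> is handled by the sub-mean inequality for \<open>ln |z|\<close> along complex lines: the mean is
explicit when the zero is off the circle, and Fatou's lemma gives the inequality when it lies on the circle
(lemma \<open>psh_on_re_plus_log\<close>).
\<close>

section \<open>Means over circles\<close>

text \<open>
For a continuous real function the mean over a circle can be taken as an ordinary gauge integral.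
This is the form in which Cauchy's formula delivers mean values.
\<close>
definition real_circle_mean :: "(complex \<Rightarrow> real) \<Rightarrow> complex \<Rightarrow> real \<Rightarrow> real" where
  "real_circle_mean u c r = integral {0..2 * pi} (\<lambda>t. u (c + of_real r * cis t)) / (2 * pi)"

lemma circle_point_in_sphere: "0 \<le> r \<Longrightarrow> c + of_real r * cis t \<in> sphere c r"
  by (simp add: dist_norm norm_mult)

lemma continuous_on_circle_param:
  assumes "continuous_on (sphere c r) u" "0 \<le> r"
  shows "continuous_on S (\<lambda>t. u (c + of_real r * cis t))"
  by (rule continuous_on_compose2[OF assms(1)])
     (use assms(2) circle_point_in_sphere in \<open>auto intro!: continuous_intros\<close>)

lemma nn_integral_continuous_Icc:
  fixes g :: "real \<Rightarrow> real"
  assumes "continuous_on {a..b} g" "\<And>t. t \<in> {a..b} \<Longrightarrow> 0 \<le> g t"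
  shows "(\<integral>\<^sup>+ t\<in>{a..b}. ennreal (g t) \<partial>lborel) = ennreal (integral {a..b} g)"
proof -
  have si: "set_integrable lborel {a..b} g"
    by (rule borel_integrable_atLeastAtMost'[OF assms(1)])
  have "(\<integral>\<^sup>+ t\<in>{a..b}. ennreal (g t) \<partial>lborel) = (\<integral>\<^sup>+ t. ennreal (indicator {a..b} t *\<^sub>R g t) \<partial>lborel)"
    by (intro nn_integral_cong) (auto simp: indicator_def)
  also have "\<dots> = ennreal (LINT t:{a..b}|lborel. g t)"
    unfolding set_lebesgue_integral_def
    using si[unfolded set_integrable_def]
    by (intro nn_integral_eq_integral) (auto simp: indicator_def assms(2))
  also have "\<dots> = ennreal (integral {a..b} g)"
    by (simp add: set_borel_integral_eq_integral(2)[OF si])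
  finally show ?thesis .
qed

text \<open>
Both nonnegative integrals are monotone for arbitrary integrands, and subtraction on extended reals
is monotone even in the form \<open>\<infinity> - \<infinity>\<close>.
\<close>
lemma circle_mean_mono:
  assumes "0 \<le> r" "\<And>l. l \<in> sphere c r \<Longrightarrow> u l \<le> v l"
  shows "circle_mean u c r \<le> circle_mean v c r"
proof -
  have uv: "u (c + of_real r * cis t) \<le> v (c + of_real r * cis t)" for t
    by (rule assms(2)[OF circle_point_in_sphere[OF assms(1)]])
  have "(\<integral>\<^sup>+ t\<in>{0..2 * pi}. e2ennreal (u (c + of_real r * cis t)) \<partial>lborel)
      \<le> (\<integral>\<^sup>+ t\<in>{0..2 * pi}. e2ennreal (v (c + of_real r * cis t)) \<partial>lborel)"
    by (intro nn_integral_mono mult_right_mono e2ennreal_mono uv) auto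
  moreover have "(\<integral>\<^sup>+ t\<in>{0..2 * pi}. e2ennreal (- v (c + of_real r * cis t)) \<partial>lborel)
      \<le> (\<integral>\<^sup>+ t\<in>{0..2 * pi}. e2ennreal (- u (c + of_real r * cis t)) \<partial>lborel)"
    by (intro nn_integral_mono mult_right_mono e2ennreal_mono) (auto simp: uv)
  ultimately show ?thesis
    unfolding circle_mean_def
    by (intro ereal_divide_right_mono ereal_minus_mono) (auto simp: less_eq_ennreal.rep_eq)
qed

lemma circle_mean_real:
  assumes "continuous_on (sphere c r) u" "0 \<le> r"
  shows "circle_mean (\<lambda>l. ereal (u l)) c r = ereal (real_circle_mean u c r)"
proof -
  define g where "g = (\<lambda>t. u (c + of_real r * cis t))"
  have cg: "continuous_on {0..2*pi} g"
    unfolding g_def by (rule continuous_on_circle_param[OF assms])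
  have cp: "continuous_on {0..2*pi} (\<lambda>t. max 0 (g t))" "continuous_on {0..2*pi} (\<lambda>t. max 0 (- g t))"
    by (intro continuous_intros cg)+
  have e: "e2ennreal (ereal x) = ennreal (max 0 x)" for x
    by (cases "0 \<le> x") (auto simp: e2ennreal_ereal e2ennreal_neg ennreal_neg max_def)
  have p: "(\<integral>\<^sup>+ t\<in>{0..2 * pi}. e2ennreal (ereal (g t)) \<partial>lborel)
     = ennreal (integral {0..2*pi} (\<lambda>t. max 0 (g t)))"
    unfolding e by (rule nn_integral_continuous_Icc[OF cp(1)]) simp
  have n: "(\<integral>\<^sup>+ t\<in>{0..2 * pi}. e2ennreal (- ereal (g t)) \<partial>lborel)
     = ennreal (integral {0..2*pi} (\<lambda>t. max 0 (- g t)))"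
    unfolding uminus_ereal.simps e by (rule nn_integral_continuous_Icc[OF cp(2)]) simp
  have "integral {0..2*pi} (\<lambda>t. max 0 (g t)) - integral {0..2*pi} (\<lambda>t. max 0 (- g t))
      = integral {0..2*pi} (\<lambda>t. max 0 (g t) - max 0 (- g t))"
    by (intro integral_diff[symmetric] integrable_continuous_real cp)
  also have "\<dots> = integral {0..2*pi} g"
    by (rule arg_cong[where f="integral _"]) (auto simp: max_def)
  finally have d: "integral {0..2*pi} (\<lambda>t. max 0 (g t)) - integral {0..2*pi} (\<lambda>t. max 0 (- g t))
      = integral {0..2*pi} g" .
  have "0 \<le> integral {0..2*pi} (\<lambda>t. max 0 (g t))" "0 \<le> integral {0..2*pi} (\<lambda>t. max 0 (- g t))"
    by (intro integral_nonneg integrable_continuous_real cp; simp)+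
  then show ?thesis
    unfolding circle_mean_def real_circle_mean_def
    using p n d by (simp add: g_def enn2ereal_ennreal)
qed

lemma real_circle_mean_add:
  assumes "continuous_on (sphere c r) u" "continuous_on (sphere c r) v" "0 \<le> r"
  shows "real_circle_mean (\<lambda>l. u l + v l) c r = real_circle_mean u c r + real_circle_mean v c r"
  unfolding real_circle_mean_def
  by (subst integral_add)
     (use assms in \<open>auto intro!: integrable_continuous_real continuous_on_circle_param simp: add_divide_distrib\<close>)

lemma real_circle_mean_cmult:
  "real_circle_mean (\<lambda>l. k * u l) c r = k * real_circle_mean u c r"
  unfolding real_circle_mean_def by simp

lemma real_circle_mean_const: "real_circle_mean (\<lambda>l. k) c r = k"
  unfolding real_circle_mean_def by simp

lemma real_circle_mean_cong:
  assumes "0 \<le> r" "\<And>l. l \<in> sphere c r \<Longrightarrow> u l = v l"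
  shows "real_circle_mean u c r = real_circle_mean v c r"
  unfolding real_circle_mean_def using assms(2)[OF circle_point_in_sphere[OF assms(1)]] by simp

lemma real_circle_mean_mono:
  assumes "continuous_on (sphere c r) u" "continuous_on (sphere c r) v" "0 \<le> r"
    "\<And>l. l \<in> sphere c r \<Longrightarrow> u l \<le> v l"
  shows "real_circle_mean u c r \<le> real_circle_mean v c r"
  using circle_mean_mono[of r c "\<lambda>l. ereal (u l)" "\<lambda>l. ereal (v l)"] assms
  by (simp add: circle_mean_real)

text \<open>
Cauchy's formula at the centre: on the circle the factor \<open>1 / (u - c)\<close> cancels against the
derivative of the parametrization.
\<close>
lemma real_circle_mean_Re_holomorphic:
  assumes "f holomorphic_on cball c r" "0 < r"
  shows "real_circle_mean (\<lambda>l. Re (f l)) c r = Re (f c)"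
proof -
  have "((\<lambda>u. f u / (u - c)) has_contour_integral (2 * of_real pi * \<i> * f c)) (circlepath c r)"
    by (rule Cauchy_integral_circlepath_simple[OF assms(1)]) (use assms(2) in simp)
  then have "((\<lambda>t. f (c + of_real r * cis t) / (c + of_real r * cis t - c) * of_real r * \<i> * cis t)
      has_integral (2 * of_real pi * \<i> * f c)) {0..2*pi}"
    unfolding circlepath_def by (subst (asm) has_contour_integral_part_circlepath_iff) auto
  then have "((\<lambda>t. \<i> * f (c + of_real r * cis t)) has_integral (2 * of_real pi * \<i> * f c)) {0..2*pi}"
    using assms(2) by (simp add: mult.commute)
  from has_integral_mult_right[OF this, of "- \<i>"]
  have "((\<lambda>t. f (c + of_real r * cis t)) has_integral (2 * of_real pi * f c)) {0..2*pi}"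
    by (simp add: algebra_simps)
  from has_integral_linear[OF this bounded_linear_Re]
  have "((\<lambda>t. Re (f (c + of_real r * cis t))) has_integral (2 * pi * Re (f c))) {0..2*pi}"
    by (simp add: o_def)
  then show ?thesis
    unfolding real_circle_mean_def by (simp add: integral_unique)
qed

section \<open>Plurisubharmonic functions\<close>

lemma usc_on_continuous_real:
  assumes "continuous_on S f"
  shows "usc_on S (\<lambda>z. ereal (f z))"
  unfolding usc_on_def
proof
  fix c
  have "continuous_on S (\<lambda>z. ereal (f z))"
    by (intro continuous_intros assms)
  from continuous_openin_preimage_gen[OF this open_lessThan]
  have "openin (top_of_set S) (S \<inter> (\<lambda>z. ereal (f z)) -` {..<c})" .
  moreover have "S \<inter> (\<lambda>z. ereal (f z)) -` {..<c} = {z \<in> S. ereal (f z) < c}" by auto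
  ultimately show "openin (top_of_set S) {z \<in> S. ereal (f z) < c}" by simp
qed

lemma usc_on_compose:
  assumes "usc_on S u" "continuous_on T g" "g ` T \<subseteq> S"
  shows "usc_on T (\<lambda>x. u (g x))"
  unfolding usc_on_def
proof
  fix c
  have "openin (top_of_set S) {z \<in> S. u z < c}"
    using assms(1) by (simp add: usc_on_def)
  from continuous_openin_preimage[OF assms(2) _ this] assms(3)
  have "openin (top_of_set T) (T \<inter> g -` {z \<in> S. u z < c})" by blast
  moreover have "T \<inter> g -` {z \<in> S. u z < c} = {x \<in> T. u (g x) < c}"
    using assms(3) by auto
  ultimately show "openin (top_of_set T) {x \<in> T. u (g x) < c}" by simp
qed

lemma continuous_on_complex_line: "continuous_on S (\<lambda>l. a + l *s (w :: complex^'n))"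
proof -
  have "(\<lambda>l. a + l *s w) = (\<lambda>l. \<chi> i. a $ i + l * w $ i)"
    by (auto simp: vec_eq_iff)
  then show ?thesis by (simp only:) (intro continuous_intros)
qed

lemma psh_onI:
  fixes u :: "complex^'n \<Rightarrow> ereal"
  assumes "usc_on \<Omega> u" "\<And>z. z \<in> \<Omega> \<Longrightarrow> u z < \<infinity>"
    and "\<And>a w c r. 0 < r \<Longrightarrow> (\<And>l. l \<in> cball c r \<Longrightarrow> a + l *s w \<in> \<Omega>) \<Longrightarrow>
           u (a + c *s w) \<le> circle_mean (\<lambda>l. u (a + l *s w)) c r"
  shows "psh_on \<Omega> u"
  unfolding psh_on_def subharmonic_on_def
proof (intro conjI allI impI ballI)
  fix a w
  show "usc_on {l. a + l *s w \<in> \<Omega>} (\<lambda>l. u (a + l *s w))"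
    by (rule usc_on_compose[OF assms(1) continuous_on_complex_line]) auto
  show "u (a + l *s w) < \<infinity>" if "l \<in> {l. a + l *s w \<in> \<Omega>}" for l
    using that assms(2) by blast
  show "u (a + c *s w) \<le> circle_mean (\<lambda>l. u (a + l *s w)) c r"
    if "0 < r \<and> cball c r \<subseteq> {l. a + l *s w \<in> \<Omega>}" for c r
    using that by (intro assms(3)) auto
qed (rule assms(1), rule assms(2))

lemma psh_onD_mean:
  fixes u :: "complex^'n \<Rightarrow> ereal"
  assumes "psh_on \<Omega> u" "0 < r" "\<And>l. l \<in> cball c r \<Longrightarrow> a + l *s w \<in> \<Omega>"
  shows "u (a + c *s w) \<le> circle_mean (\<lambda>l. u (a + l *s w)) c r"
proof -
  have "subharmonic_on {l. a + l *s w \<in> \<Omega>} (\<lambda>l. u (a + l *s w))"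
    using assms(1) by (simp only: psh_on_def)
  moreover have "cball c r \<subseteq> {l. a + l *s w \<in> \<Omega>}" using assms(3) by (intro subsetI CollectI)
  ultimately show ?thesis using assms(2) unfolding subharmonic_on_def by blast
qed

lemma continuous_on_line_sphere:
  fixes u :: "complex^'n \<Rightarrow> 'b::topological_space"
  assumes "continuous_on \<Omega> u" "\<And>l. l \<in> cball c r \<Longrightarrow> a + l *s w \<in> \<Omega>"
  shows "continuous_on (sphere c r) (\<lambda>l. u (a + l *s w))"
proof (rule continuous_on_compose2[OF assms(1) continuous_on_complex_line], rule image_subsetI)
  fix l assume "l \<in> sphere c r"
  then show "a + l *s w \<in> \<Omega>" by (intro assms(2)) simp
qed

lemma psh_on_real_iff:
  fixes u :: "complex^'n \<Rightarrow> real"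
  assumes "continuous_on \<Omega> u"
  shows "psh_on \<Omega> (\<lambda>z. ereal (u z)) \<longleftrightarrow>
    (\<forall>a w c r. 0 < r \<longrightarrow> (\<forall>l\<in>cball c r. a + l *s w \<in> \<Omega>) \<longrightarrow>
       u (a + c *s w) \<le> real_circle_mean (\<lambda>l. u (a + l *s w)) c r)" (is "?L \<longleftrightarrow> ?R")
proof
  assume ?L
  show ?R
  proof (intro allI impI)
    fix a w c and r :: real assume r: "0 < r" and sub: "\<forall>l\<in>cball c r. a + l *s w \<in> \<Omega>"
    have "ereal (u (a + c *s w)) \<le> circle_mean (\<lambda>l. ereal (u (a + l *s w))) c r"
      by (rule psh_onD_mean[OF \<open>?L\<close> r bspec[OF sub]])
    then show "u (a + c *s w) \<le> real_circle_mean (\<lambda>l. u (a + l *s w)) c r"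
      using circle_mean_real[OF continuous_on_line_sphere[OF assms bspec[OF sub]] less_imp_le[OF r]]
      by simp
  qed
next
  assume R: ?R
  show ?L
  proof (rule psh_onI)
    fix a w c and r :: real assume r: "0 < r" and sub: "\<And>l. l \<in> cball c r \<Longrightarrow> a + l *s w \<in> \<Omega>"
    show "ereal (u (a + c *s w)) \<le> circle_mean (\<lambda>l. ereal (u (a + l *s w))) c r"
      using circle_mean_real[OF continuous_on_line_sphere[OF assms sub] less_imp_le[OF r]]
        R[rule_format, OF r sub] by simp
  qed (rule usc_on_continuous_real[OF assms], simp)
qed

text \<open>
The supremum principle behind the plurisubharmonicity proofs below: each value of \<open>F\<close> is approached
by a plurisubharmonic minorant, and the sub-mean inequality passes from the minorants to \<open>F\<close>. Continuity of \<open>F\<close> replaces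
the upper semicontinuous regularization that a supremum needs in general.
\<close>
lemma psh_on_supremum:
  fixes F :: "complex^'n \<Rightarrow> real"
  assumes "continuous_on \<Omega> F"
    and "\<And>x e. x \<in> \<Omega> \<Longrightarrow> 0 < e \<Longrightarrow>
      \<exists>v. psh_on \<Omega> v \<and> (\<forall>y\<in>\<Omega>. v y \<le> ereal (F y)) \<and> ereal (F x - e) \<le> v x"
  shows "psh_on \<Omega> (\<lambda>x. ereal (F x))"
proof (rule psh_onI)
  fix a w c and r :: real assume r: "0 < r" and sub: "\<And>l. l \<in> cball c r \<Longrightarrow> a + l *s w \<in> \<Omega>"
  define m where "m = real_circle_mean (\<lambda>l. F (a + l *s w)) c r"
  have m: "circle_mean (\<lambda>l. ereal (F (a + l *s w))) c r = ereal m"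
    unfolding m_def
    by (rule circle_mean_real[OF continuous_on_line_sphere[OF assms(1) sub] less_imp_le[OF r]])
  have "F (a + c *s w) \<le> m + e" if e: "0 < e" for e
  proof -
    have cO: "a + c *s w \<in> \<Omega>" by (rule sub) (use r in simp)
    obtain v where v: "psh_on \<Omega> v \<and> (\<forall>y\<in>\<Omega>. v y \<le> ereal (F y)) \<and>
        ereal (F (a + c *s w) - e) \<le> v (a + c *s w)"
      using assms(2)[OF cO e] by (rule exE)
    have "ereal (F (a + c *s w) - e) \<le> v (a + c *s w)" using v by (elim conjE)
    also have "v (a + c *s w) \<le> circle_mean (\<lambda>l. v (a + l *s w)) c r"
      by (rule psh_onD_mean[OF conjunct1[OF v] r sub])
    also have "\<dots> \<le> circle_mean (\<lambda>l. ereal (F (a + l *s w))) c r"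
    proof (rule circle_mean_mono)
      fix l assume "l \<in> sphere c r"
      then have "a + l *s w \<in> \<Omega>" by (intro sub) auto
      then show "v (a + l *s w) \<le> ereal (F (a + l *s w))" using v by blast
    qed (use r in simp)
    finally show ?thesis by (simp add: m)
  qed
  then have "F (a + c *s w) \<le> m" by (rule field_le_epsilon)
  then show "ereal (F (a + c *s w)) \<le> circle_mean (\<lambda>l. ereal (F (a + l *s w))) c r"
    by (simp add: m)
qed (rule usc_on_continuous_real[OF assms(1)], simp)

lemma psh_on_Re_holomorphic:
  fixes \<Phi> :: "complex^'n \<Rightarrow> complex"
  assumes "continuous_on \<Omega> \<Phi>"
    and "\<And>a w. (\<lambda>l. \<Phi> (a + l *s w)) holomorphic_on {l. a + l *s w \<in> \<Omega>}"
  shows "psh_on \<Omega> (\<lambda>x. ereal (Re (\<Phi> x)))"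
proof -
  have "continuous_on \<Omega> (\<lambda>x. Re (\<Phi> x))" by (intro continuous_intros assms)
  note iff = psh_on_real_iff[OF this]
  show ?thesis
    unfolding iff
  proof (intro allI impI)
    fix a w c and r :: real assume r: "0 < r" and sub: "\<forall>l\<in>cball c r. a + l *s w \<in> \<Omega>"
    have "cball c r \<subseteq> {l. a + l *s w \<in> \<Omega>}" using bspec[OF sub] by (intro subsetI CollectI)
    from real_circle_mean_Re_holomorphic[OF holomorphic_on_subset[OF assms(2) this] r]
    show "Re (\<Phi> (a + c *s w)) \<le> real_circle_mean (\<lambda>l. Re (\<Phi> (a + l *s w))) c r"
      by (simp only: order_refl)
  qed
qed

lemma psh_on_const: "psh_on \<Omega> (\<lambda>x :: complex^'n. ereal k)"
  using psh_on_Re_holomorphic[of \<Omega> "\<lambda>x. of_real k"] by simp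

text \<open>
Affine real functions are pluriharmonic; the paraboloids in the construction of boundary extensions
are affine functions minus a multiple of \<open>(norm x)\<^sup>2\<close>.
\<close>
lemma psh_on_inner: "psh_on \<Omega> (\<lambda>x :: complex^'n. ereal (x \<bullet> p))"
proof -
  have "psh_on \<Omega> (\<lambda>x. ereal (Re (\<Sum>i\<in>UNIV. x $ i * cnj (p $ i))))"
    by (rule psh_on_Re_holomorphic) (auto intro!: continuous_intros holomorphic_intros)
  then show ?thesis by (simp add: inner_vec_def inner_complex_def)
qed

lemma psh_on_add_scaled_real:
  fixes u v :: "complex^'n \<Rightarrow> real"
  assumes "continuous_on \<Omega> u" "continuous_on \<Omega> v"
    "psh_on \<Omega> (\<lambda>x. ereal (u x))" "psh_on \<Omega> (\<lambda>x. ereal (v x))" "0 \<le> k"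
  shows "psh_on \<Omega> (\<lambda>x. ereal (u x + k * v x))"
proof -
  have "continuous_on \<Omega> (\<lambda>x. u x + k * v x)" by (intro continuous_intros assms)
  note iff = psh_on_real_iff[OF this]
  show ?thesis
    unfolding iff
  proof (intro allI impI)
    fix a w c and r :: real assume r: "0 < r" and sub: "\<forall>l\<in>cball c r. a + l *s w \<in> \<Omega>"
    have cu: "continuous_on (sphere c r) (\<lambda>l. u (a + l *s w))"
      and cv: "continuous_on (sphere c r) (\<lambda>l. v (a + l *s w))"
      by (rule continuous_on_line_sphere[OF assms(1) bspec[OF sub]]
          continuous_on_line_sphere[OF assms(2) bspec[OF sub]]; assumption)+
    have "real_circle_mean (\<lambda>l. u (a + l *s w) + k * v (a + l *s w)) c r
      = real_circle_mean (\<lambda>l. u (a + l *s w)) c r + k * real_circle_mean (\<lambda>l. v (a + l *s w)) c r"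
      using real_circle_mean_add[OF cu continuous_on_mult_left[OF cv] less_imp_le[OF r]]
      by (simp only: real_circle_mean_cmult)
    moreover have "u (a + c *s w) \<le> real_circle_mean (\<lambda>l. u (a + l *s w)) c r"
      using psh_on_real_iff[OF assms(1), THEN iffD1, OF assms(3)] r sub by blast
    moreover have "v (a + c *s w) \<le> real_circle_mean (\<lambda>l. v (a + l *s w)) c r"
      using psh_on_real_iff[OF assms(2), THEN iffD1, OF assms(4)] r sub by blast
    ultimately show "u (a + c *s w) + k * v (a + c *s w)
      \<le> real_circle_mean (\<lambda>l. u (a + l *s w) + k * v (a + l *s w)) c r"
      using assms(5) by (simp only: add_mono mult_left_mono)
  qed
qed

section \<open>A criterion for B-regularity\<close>

text \<open>
Fix a continuous \<open>g\<close> on the closure, and a function \<open>\<rho>\<close> that vanishes on the frontier and is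
negative inside. The index set consists of all downward paraboloids \<open>c - n (norm (x - p))\<^sup>2\<close> lying below \<open>g\<close>
on the closure, and to each of them \<open>n \<rho>\<close> is added, with the same steepness \<open>n\<close>. The supremum \<open>F\<close> stays
below \<open>g\<close>, and agrees with it on the frontier, where \<open>\<rho> = 0\<close> and where steep paraboloids reach
up to \<open>g\<close>.

As a supremum of continuous functions, \<open>F\<close> is lower semicontinuous. At a frontier point it is upper
semicontinuous because \<open>F \<le> g\<close>. At an interior point the term \<open>n \<rho>\<close> pushes all paraboloids of
large steepness below \<open>F\<close>, and those of bounded steepness are equicontinuous.
\<close>
lemma continuous_on_supremum_of_barriers:
  fixes \<Omega> :: "'a::euclidean_space set" and g \<rho> :: "'a \<Rightarrow> real"
  defines "I \<equiv> {(n, p, c). 0 \<le> n \<and> p \<in> closure \<Omega> \<and> (\<forall>y\<in>closure \<Omega>. c - n * (norm (y - p))\<^sup>2 \<le> g y)}"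
  defines "m \<equiv> \<lambda>i x. case i of (n, p, c) \<Rightarrow> c - n * (norm (x - p))\<^sup>2 + n * \<rho> x"
  defines "F \<equiv> \<lambda>x. SUP i\<in>I. m i x"
  assumes bnd: "bounded \<Omega>" and ne: "\<Omega> \<noteq> {}" and op: "open \<Omega>"
    and cg: "continuous_on (closure \<Omega>) g" and cr: "continuous_on (closure \<Omega>) \<rho>"
    and vanish: "\<forall>x\<in>frontier \<Omega>. \<rho> x = 0" and neg: "\<forall>x\<in>\<Omega>. \<rho> x < 0"
  shows "continuous_on (closure \<Omega>) F"
    and "\<And>x. x \<in> frontier \<Omega> \<Longrightarrow> F x = g x"
    and "\<And>i x. i \<in> I \<Longrightarrow> x \<in> closure \<Omega> \<Longrightarrow> m i x \<le> F x"
    and "\<And>x e. x \<in> closure \<Omega> \<Longrightarrow> 0 < e \<Longrightarrow> \<exists>i\<in>I. F x - e < m i x"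
proof -
  let ?K = "closure \<Omega>"
  note r0 = bspec[OF vanish] and rneg = bspec[OF neg]
  have comp: "compact ?K" using bnd by (simp add: compact_closure)
  have dich: "x \<in> \<Omega> \<or> x \<in> frontier \<Omega>" if "x \<in> ?K" for x
    using that op by (auto simp: frontier_def interior_open)
  have rle: "\<rho> x \<le> 0" if "x \<in> ?K" for x
    using dich[OF that] r0 rneg by force
  obtain R where R: "\<And>x. x \<in> ?K \<Longrightarrow> norm x \<le> R"
    using compact_imp_bounded[OF comp] by (auto simp: bounded_iff)
  have "bounded (g ` ?K)"
    using compact_continuous_image[OF cg comp] compact_imp_bounded by blast
  then obtain B where B: "\<And>x. x \<in> ?K \<Longrightarrow> \<bar>g x\<bar> \<le> B"
    by (auto simp: bounded_iff)
  have mle: "m i x \<le> g x" if "i \<in> I" "x \<in> ?K" for i x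
  proof -
    obtain n p c where i: "i = (n, p, c)" by (cases i)
    have "n * \<rho> x \<le> 0" using that rle[OF that(2)] by (auto simp: I_def i mult_nonneg_nonpos)
    moreover have "c - n * (norm (x - p))\<^sup>2 \<le> g x" using that by (auto simp: I_def i)
    ultimately show ?thesis by (simp add: m_def i)
  qed
  have bdd: "bdd_above ((\<lambda>i. m i x) ` I)" if "x \<in> ?K" for x
    using mle that by (intro bdd_aboveI2)
  obtain p0 where p0: "p0 \<in> ?K" using ne closure_subset by blast
  have "(0, p0, - B) \<in> I" using p0 B by (force simp: I_def)
  then have Ine: "I \<noteq> {}" by blast
  show upper: "\<And>i x. i \<in> I \<Longrightarrow> x \<in> ?K \<Longrightarrow> m i x \<le> F x"
    unfolding F_def by (rule cSUP_upper[OF _ bdd])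
  have Fle: "F x \<le> g x" if "x \<in> ?K" for x
    unfolding F_def using mle that by (intro cSUP_least Ine)
  have less: "\<exists>i\<in>I. b < m i x" if "x \<in> ?K" "b < F x" for b x
    using that less_cSUP_iff[OF Ine bdd[OF that(1)], of b] unfolding F_def by blast
  then show "\<And>x e. x \<in> ?K \<Longrightarrow> 0 < e \<Longrightarrow> \<exists>i\<in>I. F x - e < m i x" by simp
  show bdry: "\<And>x. x \<in> frontier \<Omega> \<Longrightarrow> F x = g x"
  proof -
    fix p assume p: "p \<in> frontier \<Omega>"
    then have pK: "p \<in> ?K" by (simp add: frontier_def)
    have "g p \<le> F p + e" if e: "0 < e" for e
    proof -
      from cg pK e obtain d where d: "0 < d" "\<And>y. y \<in> ?K \<Longrightarrow> dist y p < d \<Longrightarrow> dist (g y) (g p) < e"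
        unfolding continuous_on_iff by blast
      \<comment> \<open>Steep enough that outside the ball of radius \<open>d\<close> the paraboloid has dropped by the
        oscillation bound \<open>2 * B\<close> of \<open>g\<close>.\<close>
      define n where "n = 2 * B / d\<^sup>2"
      have B0: "0 \<le> B" using B[OF pK] by linarith
      then have n0: "0 \<le> n" by (simp add: n_def)
      have "g p - e - n * (norm (y - p))\<^sup>2 \<le> g y" if y: "y \<in> ?K" for y
      proof (cases "dist y p < d")
        case True
        then have "g p - e \<le> g y" using d(2)[OF y] by (auto simp: dist_real_def)
        moreover have "0 \<le> n * (norm (y - p))\<^sup>2" using n0 by simp
        ultimately show ?thesis by linarith
      next
        case False
        then have "d\<^sup>2 \<le> (norm (y - p))\<^sup>2" using d(1) by (intro power_mono) (auto simp: dist_norm)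
        then have "n * d\<^sup>2 \<le> n * (norm (y - p))\<^sup>2" using n0 by (intro mult_left_mono)
        moreover have "n * d\<^sup>2 = 2 * B" using d(1) by (simp add: n_def)
        ultimately show ?thesis using B[OF y] B[OF pK] e by linarith
      qed
      then have "(n, p, g p - e) \<in> I" using n0 pK by (simp add: I_def)
      from upper[OF this pK] show ?thesis using r0[OF p] by (simp add: m_def)
    qed
    then have "g p \<le> F p" by (rule field_le_epsilon)
    with Fle[OF pK] show "F p = g p" by simp
  qed
  have mcont: "continuous_on ?K (m i)" for i
    unfolding m_def by (cases i) (auto intro!: continuous_intros cr)
  show "continuous_on ?K F"
    unfolding continuous_on_def
  proof (intro ballI order_tendstoI)
    fix x a assume x: "x \<in> ?K" and a: "a < F x"
    from less[OF this] obtain i where i: "i \<in> I" "a < m i x" by blast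
    have "(m i \<longlongrightarrow> m i x) (at x within ?K)" using mcont[of i] x by (simp add: continuous_on_def)
    from order_tendstoD(1)[OF this i(2)]
    have "\<forall>\<^sub>F y in at x within ?K. a < m i y" .
    moreover have "\<forall>\<^sub>F y in at x within ?K. y \<in> ?K" by (simp add: eventually_at_filter)
    ultimately show "\<forall>\<^sub>F y in at x within ?K. a < F y"
      by eventually_elim (use upper[OF i(1)] in force)
  next
    fix x b assume x: "x \<in> ?K" and b: "F x < b"
    have inK: "\<forall>\<^sub>F y in at x within ?K. y \<in> ?K" by (simp add: eventually_at_filter)
    show "\<forall>\<^sub>F y in at x within ?K. F y < b"
    proof (cases "x \<in> frontier \<Omega>")
      case True
      have "(g \<longlongrightarrow> g x) (at x within ?K)" using cg x by (simp add: continuous_on_def)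
      from order_tendstoD(2)[OF this, of b] bdry[OF True] b
      have "\<forall>\<^sub>F y in at x within ?K. g y < b" by simp
      then show ?thesis using inK by eventually_elim (use Fle in force)
    next
      case False
      then have xO: "x \<in> \<Omega>" using dich[OF x] by blast
      define \<eta> where "\<eta> = - \<rho> x / 2"
      have \<eta>: "0 < \<eta>" using rneg[OF xO] by (simp add: \<eta>_def)
      \<comment> \<open>Near \<open>x\<close>, where \<open>\<rho> \<le> - \<eta>\<close>, paraboloids of steepness at least \<open>N\<close> stay below the value \<open>F x\<close>.\<close>
      define N where "N = \<bar>B - F x\<bar> / \<eta>"
      have N0: "0 \<le> N" using \<eta> by (simp add: N_def)
      have R0: "0 \<le> R" using R[OF x] norm_ge_zero[of x] by linarith
      define e where "e = (b - F x) / 2"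
      have e: "0 < e" using b by (simp add: e_def)
      define d where "d = e / ((N + 1) * (1 + 4 * R))"
      have d: "0 < d" using e N0 R0 by (simp add: d_def)
      have "(\<rho> \<longlongrightarrow> \<rho> x) (at x within ?K)" using cr x by (simp add: continuous_on_def)
      then have "\<forall>\<^sub>F y in at x within ?K. dist (\<rho> y) (\<rho> x) < min d \<eta>"
        using d \<eta> by (intro tendstoD) auto
      moreover have "\<forall>\<^sub>F y in at x within ?K. dist y x < d"
        using tendstoD[OF tendsto_ident_at d] .
      ultimately show ?thesis using inK
      proof eventually_elim
        fix y assume y1: "dist (\<rho> y) (\<rho> x) < min d \<eta>" and y2: "dist y x < d" and y: "y \<in> ?K"
        have "m i y \<le> F x + e" if iI: "i \<in> I" for i
        proof -
          obtain n p c where i: "i = (n, p, c)" by (cases i)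
          have n0: "0 \<le> n" and p: "p \<in> ?K" and c: "c - n * (norm (y - p))\<^sup>2 \<le> g y"
            using iI y by (auto simp: I_def i)
          show ?thesis
          proof (cases "N \<le> n")
            case True
            have "\<rho> y \<le> - \<eta>" using y1 by (auto simp: dist_real_def \<eta>_def)
            then have "n * \<rho> y \<le> n * (- \<eta>)" using n0 by (intro mult_left_mono)
            also have "\<dots> \<le> N * (- \<eta>)" using True \<eta> by simp
            also have "\<dots> = - \<bar>B - F x\<bar>" using \<eta> by (simp add: N_def)
            finally have "m i y \<le> g y - \<bar>B - F x\<bar>" using c by (simp add: m_def i)
            then show ?thesis using B[OF y] e by linarith
          next
            case False
            have "\<bar>norm (y - p) - norm (x - p)\<bar> \<le> norm (y - x)"
              using norm_triangle_ineq3[of "y - p" "x - p"] by simp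
            moreover have "norm (y - p) + norm (x - p) \<le> 4 * R"
              using norm_triangle_ineq4[of y p] norm_triangle_ineq4[of x p] R[OF x] R[OF y] R[OF p]
              by linarith
            ultimately have "\<bar>norm (y - p) - norm (x - p)\<bar> * (norm (y - p) + norm (x - p))
                \<le> d * (4 * R)"
              using y2 d by (intro mult_mono) (auto simp: dist_norm)
            moreover have "(norm (x - p))\<^sup>2 - (norm (y - p))\<^sup>2
                \<le> \<bar>norm (y - p) - norm (x - p)\<bar> * (norm (y - p) + norm (x - p))"
            proof -
              have "(norm (x - p))\<^sup>2 - (norm (y - p))\<^sup>2
                = (norm (x - p) - norm (y - p)) * (norm (y - p) + norm (x - p))"
                by (simp add: power2_eq_square algebra_simps)
              also have "\<dots> \<le> \<bar>norm (y - p) - norm (x - p)\<bar> * (norm (y - p) + norm (x - p))"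
                by (intro mult_right_mono) auto
              finally show ?thesis .
            qed
            moreover have "\<rho> y - \<rho> x \<le> d" using y1 by (auto simp: dist_real_def)
            ultimately have s: "((norm (x - p))\<^sup>2 - (norm (y - p))\<^sup>2) + (\<rho> y - \<rho> x) \<le> d * (1 + 4 * R)"
              by (simp add: algebra_simps)
            have "m i y - m i x = n * (((norm (x - p))\<^sup>2 - (norm (y - p))\<^sup>2) + (\<rho> y - \<rho> x))"
              by (simp add: m_def i algebra_simps)
            also have "\<dots> \<le> n * (d * (1 + 4 * R))" by (rule mult_left_mono[OF s n0])
            also have "\<dots> \<le> (N + 1) * (d * (1 + 4 * R))"
              using False d R0 by (intro mult_right_mono) auto
            also have "\<dots> = e" using N0 R0 by (simp add: d_def)
            finally show ?thesis using upper[OF iI x] by simp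
          qed
        qed
        then have "F y \<le> F x + e" unfolding F_def by (intro cSUP_least Ine)
        then show "F y < b" using b by (simp add: e_def field_simps)
      qed
    qed
  qed
qed

text \<open>
A bounded domain is B-regular as soon as it has one strictly plurisubharmonic defining function
that is continuous up to the boundary. Plurisubharmonicity of \<open>\<rho> - (norm x)\<^sup>2\<close> is exactly what makes
a paraboloid plus \<open>n \<rho>\<close> plurisubharmonic: the quadratic parts combine to \<open>n (\<rho> - (norm x)\<^sup>2)\<close> and
an affine function remains.
\<close>
lemma B_regular_if_strict_psh_exhaustion:
  fixes \<Omega> :: "(complex^'n) set" and \<rho> :: "complex^'n \<Rightarrow> real"
  assumes dom: "bounded_domain \<Omega>" and cr: "continuous_on (closure \<Omega>) \<rho>"
    and r0: "\<And>x. x \<in> frontier \<Omega> \<Longrightarrow> \<rho> x = 0" and rneg: "\<And>x. x \<in> \<Omega> \<Longrightarrow> \<rho> x < 0"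
    and strict: "psh_on \<Omega> (\<lambda>x. ereal (\<rho> x - (norm x)\<^sup>2))"
  shows "B_regular \<Omega>"
  unfolding B_regular_def
proof (intro conjI allI impI dom)
  fix f :: "complex^'n \<Rightarrow> real" assume "continuous_on (frontier \<Omega>) f"
  then obtain g where g: "continuous_on UNIV g" "\<And>x. x \<in> frontier \<Omega> \<Longrightarrow> g x = f x"
    by (rule Tietze_unbounded[of _ f UNIV]) auto
  have cg: "continuous_on (closure \<Omega>) g" using g(1) continuous_on_subset by blast
  have dom': "bounded \<Omega>" "\<Omega> \<noteq> {}" "open \<Omega>" using dom by (auto simp: bounded_domain_def)
  have "\<forall>x\<in>frontier \<Omega>. \<rho> x = 0" "\<forall>x\<in>\<Omega>. \<rho> x < 0" using r0 rneg by blast+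
  note sup = continuous_on_supremum_of_barriers[OF dom' cg cr this]
  define I where "I = {(n, p, c). 0 \<le> n \<and> p \<in> closure \<Omega> \<and>
      (\<forall>y\<in>closure \<Omega>. c - n * (norm (y - p))\<^sup>2 \<le> g y)}"
  define m where "m i x = (case i of (n, p, c) \<Rightarrow> c - n * (norm (x - p))\<^sup>2 + n * \<rho> x)" for i x
  define F where "F x = (SUP i\<in>I. m i x)" for x
  have cF: "continuous_on (closure \<Omega>) F" and bF: "\<And>x. x \<in> frontier \<Omega> \<Longrightarrow> F x = g x"
    using sup(1,2) unfolding F_def I_def m_def by blast+
  have cO: "continuous_on \<Omega> \<rho>" "continuous_on \<Omega> F"
    using cr cF closure_subset continuous_on_subset by blast+
  have "psh_on \<Omega> (\<lambda>x. ereal (F x))"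
  proof (rule psh_on_supremum[OF cO(2)])
    fix x and e :: real assume x: "x \<in> \<Omega>" and e: "0 < e"
    then have xK: "x \<in> closure \<Omega>" using closure_subset by blast
    have "\<exists>i\<in>I. F x - e < m i x"
      using sup(4)[OF xK e] unfolding F_def I_def m_def .
    then obtain i where iI: "i \<in> I" and "F x - e < m i x" by (rule bexE)
    moreover obtain n p c where i: "i = (n, p, c)" by (cases i)
    ultimately have n: "0 \<le> n" and Fx: "F x - e < c - n * (norm (x - p))\<^sup>2 + n * \<rho> x"
      by (simp_all add: I_def m_def)
    define v where "v y = (c - n * (norm p)\<^sup>2) + (2 * n) * (y \<bullet> p) + n * (\<rho> y - (norm y)\<^sup>2)" for y
    have v: "v y = c - n * (norm (y - p))\<^sup>2 + n * \<rho> y" for y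
      unfolding v_def power2_norm_eq_inner by (simp add: inner_diff inner_commute algebra_simps)
    have "psh_on \<Omega> (\<lambda>y. ereal (v y))"
      unfolding v_def using n
      by (intro psh_on_add_scaled_real psh_on_const psh_on_inner strict continuous_intros cO(1)) auto
    moreover have "v y \<le> F y" if "y \<in> \<Omega>" for y
    proof -
      have "m i y \<le> F y"
        using sup(3)[of i y] iI that closure_subset unfolding F_def I_def m_def by blast
      then show ?thesis by (simp add: v m_def i)
    qed
    ultimately show "\<exists>v. psh_on \<Omega> v \<and> (\<forall>y\<in>\<Omega>. v y \<le> ereal (F y)) \<and> ereal (F x - e) \<le> v x"
      using Fx v by (intro exI[of _ "\<lambda>y. ereal (v y)"]) auto
  qed
  then show "\<exists>F. continuous_on (closure \<Omega>) F \<and> (\<forall>z\<in>frontier \<Omega>. F z = f z) \<and> psh_on \<Omega> (\<lambda>z. ereal (F z))"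
    using cF bF g(2) by (intro exI[of _ F]) simp
qed

section \<open>Logarithmic poles\<close>

text \<open>
The affine function has no zero in the closed disc, hence a holomorphic logarithm there.
\<close>
lemma real_circle_mean_ln_nonvanishing:
  assumes "0 < r" "cmod B * r < cmod A"
  shows "real_circle_mean (\<lambda>l. ln (cmod (A + B * (l - c)))) c r = ln (cmod A)"
proof -
  have A: "A \<noteq> 0" using assms by (auto simp: mult_less_0_iff not_less[symmetric])
  define f where "f l = of_real (ln (cmod A)) + Ln (1 + B * (l - c) / A)" for l
  have small: "cmod (B * (l - c) / A) < 1" if "l \<in> cball c r" for l
  proof -
    have "cmod B * cmod (l - c) \<le> cmod B * r"
      using that by (intro mult_left_mono) (auto simp: dist_norm norm_minus_commute)
    then show ?thesis using assms A by (simp add: norm_mult norm_divide)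
  qed
  have pos: "0 < Re (1 + B * (l - c) / A)" if "l \<in> cball c r" for l
    using small[OF that] abs_Re_le_cmod[of "B * (l - c) / A"] by simp
  have "f holomorphic_on cball c r"
    unfolding f_def
  proof (intro holomorphic_intros)
    fix l assume "l \<in> cball c r"
    from pos[OF this] show "1 + B * (l - c) / A \<notin> \<real>\<^sub>\<le>\<^sub>0"
      by (metis complex_nonpos_Reals_iff not_less)
  qed (use A in auto)
  from real_circle_mean_Re_holomorphic[OF this assms(1)]
  have m: "real_circle_mean (\<lambda>l. Re (f l)) c r = Re (f c)" .
  have "ln (cmod (A + B * (l - c))) = Re (f l)" if "l \<in> sphere c r" for l
  proof -
    have l: "l \<in> cball c r" using that by auto
    have nz: "1 + B * (l - c) / A \<noteq> 0" using pos[OF l] by force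
    have "A + B * (l - c) = A * (1 + B * (l - c) / A)" using A by (simp add: field_simps)
    then have "cmod (A + B * (l - c)) = cmod A * cmod (1 + B * (l - c) / A)"
      by (metis norm_mult)
    then show ?thesis
      using A nz by (simp add: f_def ln_mult Re_Ln)
  qed
  then have "real_circle_mean (\<lambda>l. ln (cmod (A + B * (l - c)))) c r = real_circle_mean (\<lambda>l. Re (f l)) c r"
    using assms(1) by (intro real_circle_mean_cong) auto
  with m show ?thesis by (simp add: f_def)
qed

text \<open>
If the zero lies inside the circle, reflection in the circle moves it outside: on the circle
the modulus of \<open>q + \<beta> (l - c)\<close> equals that of an affine function with constant term \<open>cnj \<beta> r\<close>, whose modulus
is at least that of \<open>q\<close>.
\<close>
lemma ln_le_real_circle_mean_ln:
  assumes r: "0 < r" and q: "q \<noteq> 0" and ne: "cmod \<beta> * r \<noteq> cmod q"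
  shows "ln (cmod q) \<le> real_circle_mean (\<lambda>l. ln (cmod (q + \<beta> * (l - c)))) c r"
proof (cases "cmod \<beta> * r < cmod q")
  case True
  then show ?thesis using real_circle_mean_ln_nonvanishing[OF r] by simp
next
  case False
  define A B where "A = cnj \<beta> * of_real r" and "B = cnj q / of_real r"
  have norms: "cmod A = cmod \<beta> * r" "cmod B * r = cmod q"
    using r by (simp_all add: A_def B_def norm_mult norm_divide)
  have "cmod (q + \<beta> * (l - c)) = cmod (A + B * (l - c))" if "l \<in> sphere c r" for l
  proof -
    define d where "d = l - c"
    have d: "cmod d = r" using that by (simp add: d_def dist_norm norm_minus_commute)
    have dd: "cnj d * d = of_real r * of_real r"
      using complex_norm_square[of d] d by (simp add: power2_eq_square mult.commute)
    have "cnj (q + \<beta> * d) * (d / of_real r) = cnj q * d / of_real r + cnj \<beta> * (cnj d * d) / of_real r"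
      by (simp add: algebra_simps add_divide_distrib)
    also have "\<dots> = A + B * d" unfolding dd using r by (simp add: A_def B_def)
    finally have "cmod (cnj (q + \<beta> * d) * (d / of_real r)) = cmod (A + B * d)" by simp
    moreover have "cmod (cnj (q + \<beta> * d) * (d / of_real r)) = cmod (q + \<beta> * d)"
      unfolding norm_mult complex_mod_cnj norm_divide d using r by simp
    ultimately show ?thesis by (simp add: d_def)
  qed
  then have "real_circle_mean (\<lambda>l. ln (cmod (q + \<beta> * (l - c)))) c r
      = real_circle_mean (\<lambda>l. ln (cmod (A + B * (l - c)))) c r"
    using r by (intro real_circle_mean_cong) auto
  also have "\<dots> = ln (cmod \<beta> * r)"
    using real_circle_mean_ln_nonvanishing[OF r, of B A c] norms False ne by simp
  finally have "real_circle_mean (\<lambda>l. ln (cmod (q + \<beta> * (l - c)))) c r = ln (cmod \<beta> * r)" .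
  moreover have "ln (cmod q) \<le> ln (cmod \<beta> * r)" using False q by (intro ln_mono) auto
  ultimately show ?thesis by simp
qed

text \<open>
A lower bound on the means survives pointwise limits, by Fatou's lemma applied to the nonnegative
functions \<open>N - f k\<close>. This reaches limits that take the value \<open>-\<infinity>\<close> on the circle, such as
a logarithm whose zero lies on it.
\<close>
lemma circle_mean_ge_limit:
  assumes r: "0 \<le> r" and cont: "\<And>k. continuous_on (sphere c r) (f k)"
    and bound: "\<And>k l. l \<in> sphere c r \<Longrightarrow> f k l \<le> M"
    and lim: "\<And>l. l \<in> sphere c r \<Longrightarrow> (\<lambda>k. ereal (f k l)) \<longlonglongrightarrow> u l"
    and mean: "\<And>k::nat. x \<le> real_circle_mean (f k) c r"
  shows "ereal x \<le> circle_mean u c r"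
proof -
  define N where "N = max M 0"
  have N: "0 \<le> N" "\<And>k l. l \<in> sphere c r \<Longrightarrow> f k l \<le> N"
    using bound by (auto simp: N_def max.coboundedI1)
  define I where "I = {0..2*pi}"
  define p where "p t = c + of_real r * cis t" for t
  have p: "p t \<in> sphere c r" for t unfolding p_def by (rule circle_point_in_sphere[OF r])
  have contp: "continuous_on S (\<lambda>t. f k (p t))" for S k
    unfolding p_def by (rule continuous_on_circle_param[OF cont r])
  define U where "U t = u (p t)" for t
  have limU: "(\<lambda>k. ereal (f k (p t))) \<longlonglongrightarrow> U t" for t unfolding U_def by (rule lim[OF p])
  have UN: "U t \<le> ereal N" for t
    by (rule LIMSEQ_le_const2[OF limU]) (use N(2)[OF p] in auto)
  have meas[measurable]: "U \<in> borel_measurable borel"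
  proof (rule borel_measurable_LIMSEQ_order)
    show "(\<lambda>t. ereal (f k (p t))) \<in> borel_measurable borel" for k
      by (intro borel_measurable_ereal borel_measurable_continuous_onI contp)
  qed (rule limU)
  define a where "a = (\<integral>\<^sup>+ t\<in>I. e2ennreal (ereal N - U t) \<partial>lborel)"
  define P where "P = (\<integral>\<^sup>+ t\<in>I. e2ennreal (U t) \<partial>lborel)"
  define Q where "Q = (\<integral>\<^sup>+ t\<in>I. e2ennreal (- U t) \<partial>lborel)"
  have fk: "(\<integral>\<^sup>+ t\<in>I. ennreal (N - f k (p t)) \<partial>lborel) \<le> ennreal (2 * pi * (N - x))" for k
  proof -
    have "(\<integral>\<^sup>+ t\<in>I. ennreal (N - f k (p t)) \<partial>lborel) = ennreal (integral I (\<lambda>t. N - f k (p t)))"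
      unfolding I_def using N(2)[OF p]
      by (intro nn_integral_continuous_Icc) (auto intro!: continuous_intros contp)
    also have "integral I (\<lambda>t. N - f k (p t)) = 2 * pi * N - integral I (\<lambda>t. f k (p t))"
      unfolding I_def by (subst integral_diff) (auto intro!: integrable_continuous_real contp)
    also have "\<dots> \<le> 2 * pi * (N - x)"
      using mean[of k] by (simp add: real_circle_mean_def I_def p_def field_simps)
    finally show ?thesis by (auto simp: ennreal_leI)
  qed
  have aN: "a \<le> ennreal (2 * pi * (N - x))"
  proof -
    have pt: "e2ennreal (ereal N - U t) * indicator I t
        = liminf (\<lambda>k. ennreal (N - f k (p t)) * indicator I t)" for t
    proof (rule lim_imp_Liminf[symmetric])
      have "(\<lambda>k. ereal N - ereal (f k (p t))) \<longlonglongrightarrow> ereal N - U t"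
        unfolding minus_ereal_def
        by (intro tendsto_add_ereal_general1 tendsto_intros tendsto_uminus_ereal limU) auto
      then have "(\<lambda>k. e2ennreal (ereal (N - f k (p t)))) \<longlonglongrightarrow> e2ennreal (ereal N - U t)"
        by (intro tendsto_intros) simp
      then have "(\<lambda>k. ennreal (N - f k (p t))) \<longlonglongrightarrow> e2ennreal (ereal N - U t)"
        using N(2)[OF p] by (simp add: e2ennreal_ereal)
      then show "(\<lambda>k. ennreal (N - f k (p t)) * indicator I t)
          \<longlonglongrightarrow> e2ennreal (ereal N - U t) * indicator I t"
        by (cases "t \<in> I") auto
    qed simp
    have "a = (\<integral>\<^sup>+ t. liminf (\<lambda>k. ennreal (N - f k (p t)) * indicator I t) \<partial>lborel)"
      unfolding a_def by (intro nn_integral_cong pt)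
    also have "\<dots> \<le> liminf (\<lambda>k. \<integral>\<^sup>+ t\<in>I. ennreal (N - f k (p t)) \<partial>lborel)"
    proof (rule nn_integral_liminf)
      fix k
      have "(\<lambda>t. f k (p t)) \<in> borel_measurable borel"
        by (intro borel_measurable_continuous_onI contp)
      then show "(\<lambda>t. ennreal (N - f k (p t)) * indicator I t) \<in> borel_measurable lborel"
        by (simp add: I_def)
    qed
    also have "\<dots> \<le> ennreal (2 * pi * (N - x))"
      by (intro Liminf_le always_eventually allI fk) auto
    finally show ?thesis .
  qed
  have split: "a + P = ennreal (2 * pi * N) + Q"
  proof -
    have pw: "e2ennreal (ereal N - U t) + e2ennreal (U t) = ennreal N + e2ennreal (- U t)" for t
    proof (cases "U t")
      case (real y)
      then have y: "y \<le> N" using UN[of t] by simp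
      show ?thesis
      proof (cases "0 \<le> y")
        case True
        then have "ennreal (N - y) + ennreal y = ennreal N"
          using y by (subst ennreal_plus[symmetric]) auto
        then show ?thesis using real True y by (simp add: e2ennreal_ereal ennreal_neg)
      next
        case False
        then have "ennreal N + ennreal (- y) = ennreal (N - y)"
          using N(1) by (subst ennreal_plus[symmetric]) auto
        then show ?thesis using real False y by (simp add: e2ennreal_ereal ennreal_neg)
      qed
    next
      case PInf then show ?thesis using UN[of t] by simp
    next
      case MInf then show ?thesis by (simp add: e2ennreal_neg)
    qed
    have "a + P = (\<integral>\<^sup>+ t. (e2ennreal (ereal N - U t) + e2ennreal (U t)) * indicator I t \<partial>lborel)"
      unfolding a_def P_def by (subst nn_integral_add[symmetric]) (auto simp: I_def distrib_right)
    also have "\<dots> = (\<integral>\<^sup>+ t. ennreal N * indicator I t \<partial>lborel) + Q"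
      unfolding pw Q_def by (subst nn_integral_add[symmetric]) (auto simp: I_def distrib_right)
    also have "(\<integral>\<^sup>+ t. ennreal N * indicator I t \<partial>lborel) = ennreal (2 * pi * N)"
      using N(1) by (subst nn_integral_cmult_indicator)
        (auto simp: I_def ennreal_mult[symmetric] mult.commute)
    finally show ?thesis .
  qed
  have Pfin: "P \<le> ennreal (2 * pi * N)"
  proof -
    have "P \<le> (\<integral>\<^sup>+ t. ennreal N * indicator I t \<partial>lborel)"
      unfolding P_def
    proof (intro nn_integral_mono mult_right_mono)
      show "e2ennreal (U t) \<le> ennreal N" for t
        using e2ennreal_mono[OF UN[of t]] N(1) by (simp add: e2ennreal_ereal)
    qed simp
    also have "\<dots> = ennreal (2 * pi * N)"
      using N(1) by (subst nn_integral_cmult_indicator)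
        (auto simp: I_def ennreal_mult[symmetric] mult.commute)
    finally show ?thesis .
  qed
  have xN: "x \<le> N"
  proof -
    have "real_circle_mean (f 0) c r \<le> real_circle_mean (\<lambda>_. N) c r"
      by (rule real_circle_mean_mono[OF cont _ r N(2)]) auto
    with mean[of 0] show ?thesis by (simp add: real_circle_mean_const)
  qed
  obtain a' where a': "a = ennreal a'" "0 \<le> a'"
    using aN by (cases a) (auto simp: top_unique)
  obtain P' where P': "P = ennreal P'" "0 \<le> P'"
    using Pfin by (cases P) (auto simp: top_unique)
  obtain Q' where Q': "Q = ennreal Q'" "0 \<le> Q'"
    using split a' P' by (cases Q) (auto simp: ennreal_plus[symmetric] simp del: ennreal_plus)
  have "a' + P' = 2 * pi * N + Q'"
    using split a' P' Q' N(1) by (simp add: ennreal_plus[symmetric] del: ennreal_plus)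
  moreover have "a' \<le> 2 * pi * (N - x)"
    using aN a' xN by simp
  ultimately have "2 * pi * x \<le> P' - Q'" by (simp add: algebra_simps)
  then have "x \<le> (P' - Q') / (2 * pi)" by (simp add: field_simps)
  moreover have "circle_mean u c r = ereal ((P' - Q') / (2 * pi))"
    unfolding circle_mean_def using P' Q' by (simp add: P_def Q_def I_def U_def p_def enn2ereal_ennreal)
  ultimately show ?thesis by simp
qed

text \<open>
The definition separates off the zeros of the coordinate because \<open>ln 0 = 0\<close> for the real logarithm.
\<close>
definition re_plus_log :: "(complex^'n \<Rightarrow> complex) \<Rightarrow> real \<Rightarrow> 'n \<Rightarrow> complex^'n \<Rightarrow> ereal" where
  "re_plus_log \<Phi> \<kappa> i x = (if x $ i = 0 then - \<infinity> else ereal (Re (\<Phi> x) + \<kappa> * ln (cmod (x $ i))))"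

text \<open>
Exponentiating turns a sublevel set into one defined by a continuous inequality, which gives upper
semicontinuity across the pole. On a complex line the coordinate is an affine function. Unless
its zero lies on the circle in question the mean is known; in the remaining case the zero is pushed
outside the disc by shrinking the slope by factors \<open>s k\<close> tending to \<open>1\<close>, followed by a passage to the limit.
\<close>
lemma psh_on_re_plus_log:
  fixes \<Phi> :: "complex^'n \<Rightarrow> complex"
  assumes cont: "continuous_on \<Omega> \<Phi>"
    and hol: "\<And>a w. (\<lambda>l. \<Phi> (a + l *s w)) holomorphic_on {l. a + l *s w \<in> \<Omega>}"
    and \<kappa>: "0 < \<kappa>"
  shows "psh_on \<Omega> (re_plus_log \<Phi> \<kappa> i)"
proof (rule psh_onI)
  show "usc_on \<Omega> (re_plus_log \<Phi> \<kappa> i)"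
    unfolding usc_on_def
  proof
    fix b :: ereal
    show "openin (top_of_set \<Omega>) {x \<in> \<Omega>. re_plus_log \<Phi> \<kappa> i x < b}"
    proof (cases b)
      case (real y)
      have eq: "re_plus_log \<Phi> \<kappa> i x < b \<longleftrightarrow> cmod (x $ i) - exp ((y - Re (\<Phi> x)) / \<kappa>) < 0" for x
      proof (cases "x $ i = 0")
        case False
        then have "cmod (x $ i) < exp ((y - Re (\<Phi> x)) / \<kappa>) \<longleftrightarrow> ln (cmod (x $ i)) < (y - Re (\<Phi> x)) / \<kappa>"
          by (metis exp_less_cancel_iff exp_ln zero_less_norm_iff)
        also have "\<dots> \<longleftrightarrow> Re (\<Phi> x) + \<kappa> * ln (cmod (x $ i)) < y"
          using \<kappa> by (simp add: field_simps)
        finally show ?thesis using False real by (simp add: re_plus_log_def)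
      qed (simp add: re_plus_log_def real)
      have "continuous_on \<Omega> (\<lambda>x. cmod (x $ i) - exp ((y - Re (\<Phi> x)) / \<kappa>))"
        using \<kappa> by (intro continuous_intros cont) auto
      from continuous_openin_preimage_gen[OF this open_lessThan[of 0]]
      have "openin (top_of_set \<Omega>) (\<Omega> \<inter> {x. cmod (x $ i) - exp ((y - Re (\<Phi> x)) / \<kappa>) < 0})"
        by (simp add: vimage_def)
      moreover have "\<Omega> \<inter> {x. cmod (x $ i) - exp ((y - Re (\<Phi> x)) / \<kappa>) < 0}
        = {x \<in> \<Omega>. cmod (x $ i) - exp ((y - Re (\<Phi> x)) / \<kappa>) < 0}" by auto
      ultimately show ?thesis unfolding eq by simp
    next
      case PInf
      then have "{x \<in> \<Omega>. re_plus_log \<Phi> \<kappa> i x < b} = \<Omega>" by (auto simp: re_plus_log_def)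
      then show ?thesis by simp
    qed simp
  qed
  show "re_plus_log \<Phi> \<kappa> i z < \<infinity>" for z by (simp add: re_plus_log_def)
  fix a w c and r :: real
  assume r: "0 < r" and sub: "\<And>l. l \<in> cball c r \<Longrightarrow> a + l *s w \<in> \<Omega>"
  show "re_plus_log \<Phi> \<kappa> i (a + c *s w) \<le> circle_mean (\<lambda>l. re_plus_log \<Phi> \<kappa> i (a + l *s w)) c r"
  proof (cases "(a + c *s w) $ i = 0")
    case True
    then show ?thesis by (simp add: re_plus_log_def)
  next
    case False
    define q \<beta> where "q = (a + c *s w) $ i" and "\<beta> = w $ i"
    have q: "q \<noteq> 0" using False by (simp add: q_def)
    have coord: "(a + l *s w) $ i = q + \<beta> * (l - c)" for l
      by (simp add: q_def \<beta>_def algebra_simps)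
    define h where "h l = Re (\<Phi> (a + l *s w))" for l
    have holh: "(\<lambda>l. \<Phi> (a + l *s w)) holomorphic_on cball c r"
      by (rule holomorphic_on_subset[OF hol]) (use sub in auto)
    have ch: "continuous_on (sphere c r) h"
      unfolding h_def using holomorphic_on_imp_continuous_on[OF holh]
      by (intro continuous_intros) (rule continuous_on_subset, auto)
    have "bounded (h ` sphere c r)"
      by (intro compact_imp_bounded compact_continuous_image ch compact_sphere)
    then obtain H where "\<forall>y\<in>h ` sphere c r. norm y \<le> H" unfolding bounded_iff by (rule exE)
    then have H: "h l \<le> H" if "l \<in> sphere c r" for l
      using that by (auto simp: abs_le_iff)
    \<comment> \<open>With a zero inside the circle the slope is kept, since shrinking it could move the zero
      onto the circle.\<close>
    define s where "s k = (if cmod \<beta> * r > cmod q then 1 else 1 - 1 / (real k + 2))" for k :: nat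
    have s: "0 < s k" "s k \<le> 1" for k by (auto simp: s_def field_simps)
    have sne: "cmod (of_real (s k) * \<beta>) * r \<noteq> cmod q" for k
    proof (cases "cmod \<beta> * r > cmod q")
      case True then show ?thesis by (simp add: s_def)
    next
      case False
      have "s k < 1" using False by (simp add: s_def)
      have "s k * (cmod \<beta> * r) \<le> s k * cmod q" using False s[of k] by (intro mult_left_mono) auto
      also have "\<dots> < cmod q" using \<open>s k < 1\<close> q by simp
      finally show ?thesis using s[of k] by (simp add: norm_mult mult.assoc)
    qed
    have lsph: "cmod (l - c) = r" if "l \<in> sphere c r" for l
      using that by (simp add: dist_norm norm_minus_commute)
    have nz: "q + of_real (s k) * \<beta> * (l - c) \<noteq> 0" if "l \<in> sphere c r" for k l
    proof
      assume "q + of_real (s k) * \<beta> * (l - c) = 0"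
      then have "of_real (s k) * \<beta> * (l - c) = - q" by (simp add: add_eq_0_iff)
      then have "cmod (of_real (s k) * \<beta> * (l - c)) = cmod q" by simp
      then show False using sne[of k] lsph[OF that] by (simp add: norm_mult)
    qed
    define f where "f k l = h l + \<kappa> * ln (cmod (q + of_real (s k) * \<beta> * (l - c)))" for k l
    have cln: "continuous_on (sphere c r) (\<lambda>l. ln (cmod (q + of_real (s k) * \<beta> * (l - c))))" for k
      using nz by (intro continuous_intros) auto
    have "ereal (h c + \<kappa> * ln (cmod q)) \<le> circle_mean (\<lambda>l. re_plus_log \<Phi> \<kappa> i (a + l *s w)) c r"
    proof (rule circle_mean_ge_limit[where f = f and M = "H + \<kappa> * ln (cmod q + cmod \<beta> * r)"])
      show "0 \<le> r" using r by simp
      show "continuous_on (sphere c r) (f k)" for k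
        unfolding f_def by (intro continuous_intros ch cln)
      show "f k l \<le> H + \<kappa> * ln (cmod q + cmod \<beta> * r)" if l: "l \<in> sphere c r" for k l
      proof -
        have "cmod (of_real (s k) * \<beta> * (l - c)) \<le> cmod \<beta> * r"
          using lsph[OF l] s[of k] r mult_left_le_one_le[of "cmod \<beta> * r" "s k"]
          by (simp add: norm_mult mult.assoc)
        then have "cmod (q + of_real (s k) * \<beta> * (l - c)) \<le> cmod q + cmod \<beta> * r"
          using norm_triangle_ineq[of q "of_real (s k) * \<beta> * (l - c)"] by linarith
        then have "ln (cmod (q + of_real (s k) * \<beta> * (l - c))) \<le> ln (cmod q + cmod \<beta> * r)"
          using nz[OF l] q by (subst ln_le_cancel_iff) (auto simp: add_pos_nonneg r less_imp_le)
        then show ?thesis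
          unfolding f_def using H[OF l] \<kappa> by (intro add_mono mult_left_mono) auto
      qed
      show "h c + \<kappa> * ln (cmod q) \<le> real_circle_mean (f k) c r" for k
      proof -
        have "real_circle_mean (f k) c r = real_circle_mean h c r
            + \<kappa> * real_circle_mean (\<lambda>l. ln (cmod (q + of_real (s k) * \<beta> * (l - c)))) c r"
          unfolding f_def using r
          by (simp add: real_circle_mean_add ch continuous_on_mult_left[OF cln] real_circle_mean_cmult)
        moreover have "real_circle_mean h c r = h c"
          unfolding h_def by (rule real_circle_mean_Re_holomorphic[OF holh r])
        ultimately show ?thesis
          using ln_le_real_circle_mean_ln[OF r q sne[of k], of c] \<kappa> by simp
      qed
      show "(\<lambda>k. ereal (f k l)) \<longlonglongrightarrow> re_plus_log \<Phi> \<kappa> i (a + l *s w)" if l: "l \<in> sphere c r" for l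
      proof -
        have slim: "s \<longlonglongrightarrow> 1"
        proof (cases "cmod \<beta> * r > cmod q")
          case False
          have "(\<lambda>k. 1 - 1 / (real k + 2)) \<longlonglongrightarrow> 1" by real_asymp
          then show ?thesis using False by (simp add: s_def[abs_def])
        qed (simp add: s_def[abs_def])
        show ?thesis
        proof (cases "q + \<beta> * (l - c) = 0")
          case False
          have "(\<lambda>k. f k l) \<longlonglongrightarrow> h l + \<kappa> * ln (cmod (q + of_real 1 * \<beta> * (l - c)))"
            unfolding f_def using False by (intro tendsto_intros slim) auto
          then show ?thesis
            using False by (simp add: re_plus_log_def coord h_def del: vector_add_component)
        next
          case True
          have qe: "q = - (\<beta> * (l - c))" using True by (simp add: add_eq_0_iff2)
          then have "cmod q = cmod \<beta> * r" using lsph[OF l] by (simp add: norm_mult)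
          then have sk: "s k = 1 - 1 / (real k + 2)" for k by (simp add: s_def)
          have "cmod (q + of_real (s k) * \<beta> * (l - c)) = cmod q / (real k + 2)" for k
          proof -
            have "q + of_real (s k) * \<beta> * (l - c) = of_real (1 - s k) * q"
              by (simp add: qe algebra_simps)
            then have "cmod (q + of_real (s k) * \<beta> * (l - c)) = \<bar>1 - s k\<bar> * cmod q"
              by (simp only: norm_mult norm_of_real)
            then show ?thesis by (simp add: sk)
          qed
          then have f: "f k l = h l + \<kappa> * ln (cmod q / (real k + 2))" for k
            by (simp add: f_def)
          have "0 < cmod q" using q by simp
          then have "filterlim (\<lambda>k. f k l) at_bot sequentially"
            unfolding f using \<kappa> by real_asymp
          then have "(\<lambda>k. ereal (f k l)) \<longlonglongrightarrow> - \<infinity>"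
            unfolding tendsto_MInfty filterlim_at_bot_dense by simp
          then show ?thesis using True by (simp add: re_plus_log_def coord del: vector_add_component)
        qed
      qed
    qed
    then show ?thesis using False by (simp add: re_plus_log_def q_def h_def)
  qed
qed

section \<open>Bounded subharmonic functions below the Poisson kernel\<close>

lemma usc_on_subset: "usc_on S u \<Longrightarrow> T \<subseteq> S \<Longrightarrow> usc_on T u"
  using usc_on_compose[of S u T "\<lambda>x. x"] by (simp add: continuous_on_id)

lemma usc_on_minus_continuous:
  assumes "usc_on S s" "continuous_on S k" "\<And>z. z \<in> S \<Longrightarrow> s z < \<infinity>"
  shows "usc_on S (\<lambda>z. s z - ereal (k z))"
  unfolding usc_on_def
proof
  fix b :: ereal
  show "openin (top_of_set S) {z \<in> S. s z - ereal (k z) < b}"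
  proof (cases b)
    case (real y)
    have "{z \<in> S. s z - ereal (k z) < b} = (\<Union>q. {z \<in> S. s z < ereal q} \<inter> {z \<in> S. q < k z + y})"
      (is "?A = ?B")
    proof (intro equalityI subsetI)
      fix z assume z: "z \<in> ?A"
      then have "s z < ereal (k z + y)" using real by (cases "s z") auto
      then obtain q where "s z < ereal q" "ereal q < ereal (k z + y)"
        using ereal_dense2 by blast
      then show "z \<in> ?B" using z by auto
    next
      fix z assume "z \<in> ?B"
      then obtain q where "z \<in> S" "s z < ereal q" "q < k z + y" by blast
      then show "z \<in> ?A" using real by (cases "s z") auto
    qed
    moreover have "openin (top_of_set S) {z \<in> S. q < k z + y}" for q
    proof -
      have "continuous_on S (\<lambda>z. k z + y)" by (intro continuous_intros assms)
      from continuous_openin_preimage_gen[OF this open_greaterThan[of q]]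
      have "openin (top_of_set S) (S \<inter> (\<lambda>z. k z + y) -` {q<..})" .
      moreover have "S \<inter> (\<lambda>z. k z + y) -` {q<..} = {z \<in> S. q < k z + y}" by auto
      ultimately show ?thesis by simp
    qed
    ultimately show ?thesis
      using assms(1) by (auto simp: usc_on_def intro!: openin_Union)
  next
    case PInf
    have "{z \<in> S. s z - ereal (k z) < b} = S"
      unfolding PInf using assms(3) by (auto simp: less_top[symmetric] minus_ereal_def)
    then show ?thesis by simp
  qed simp
qed

text \<open>
If the supremum were not attained, the relatively open sets \<open>{z \<in> K. u z < u l}\<close> would cover \<open>K\<close>; but a
point with the largest value among the indices of a finite subcover is not covered.
\<close>
lemma usc_on_compact_attains_sup:
  assumes "usc_on K u" "compact K" "K \<noteq> {}"
  shows "\<exists>c\<in>K. \<forall>l\<in>K. u l \<le> u c"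
proof (rule ccontr)
  assume "\<not> ?thesis"
  then have ex: "\<forall>c\<in>K. \<exists>l\<in>K. u c < u l" by (auto simp: not_le)
  define C where "C = (\<lambda>l. {z \<in> K. u z < u l}) ` K"
  have "\<forall>c\<in>C. openin (top_of_set K) c" using assms(1) by (auto simp: C_def usc_on_def)
  moreover have "K \<subseteq> \<Union>C" using ex by (auto simp: C_def)
  ultimately have "\<exists>D\<subseteq>C. finite D \<and> K \<subseteq> \<Union>D"
    using assms(2)[unfolded compact_eq_openin_cover, THEN spec[of _ C], THEN mp] by simp
  then obtain D where D: "D \<subseteq> C" "finite D" "K \<subseteq> \<Union>D" by blast
  obtain L where L: "L \<subseteq> K" "finite L" "D = (\<lambda>l. {z \<in> K. u z < u l}) ` L"
    using finite_subset_image[OF D(2), of "\<lambda>l. {z \<in> K. u z < u l}" K] D(1) unfolding C_def by blast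
  have Lne: "L \<noteq> {}" using D(3) L(3) assms(3) by auto
  have "Max (u ` L) \<in> u ` L" using L(2) Lne by (intro Max_in) auto
  then obtain m where m: "m \<in> L" "u m = Max (u ` L)" by force
  then have "m \<in> \<Union>D" using L(1) D(3) by blast
  then obtain l where l: "l \<in> L" "u m < u l" using L(3) by auto
  moreover have "u l \<le> Max (u ` L)" using l(1) L(2) by (intro Max_ge) auto
  ultimately show False using m(2) by simp
qed

text \<open>
The strict mean value inequality for \<open>k\<close> rules out a positive interior maximum of \<open>s - k\<close> at once, by
a single small circle around the maximum point.
\<close>
lemma subharmonic_le_strict_superharmonic:
  assumes sub: "subharmonic_on S s" and op: "open S" and K: "compact K" "K \<subseteq> S"
    and ck: "continuous_on S k"
    and strict: "\<And>c r. 0 < r \<Longrightarrow> cball c r \<subseteq> S \<Longrightarrow> real_circle_mean k c r < k c"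
    and out: "\<And>l. l \<in> S - K \<Longrightarrow> s l \<le> ereal (k l)"
    and l0: "l0 \<in> S"
  shows "s l0 \<le> ereal (k l0)"
proof (rule ccontr)
  assume "\<not> ?thesis"
  then have big: "ereal (k l0) < s l0" by simp
  then have l0K: "l0 \<in> K" using out[of l0] l0 by (auto simp: not_less[symmetric])
  have fin: "s z < \<infinity>" if "z \<in> S" for z using sub that by (simp add: subharmonic_on_def)
  have "usc_on S (\<lambda>z. s z - ereal (k z))"
    using sub by (intro usc_on_minus_continuous ck fin) (auto simp: subharmonic_on_def)
  from usc_on_compact_attains_sup[OF usc_on_subset[OF this K(2)] K(1)] l0K
  obtain c where c: "c \<in> K" "\<And>l. l \<in> K \<Longrightarrow> s l - ereal (k l) \<le> s c - ereal (k c)" by blast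
  have cS: "c \<in> S" using c(1) K(2) by blast
  have "0 < s l0 - ereal (k l0)" using big by (cases "s l0") auto
  with c(2)[OF l0K] have pos: "0 < s c - ereal (k c)" by simp
  then obtain y where y: "s c = ereal y" using fin[OF cS] by (cases "s c") auto
  define m where "m = y - k c"
  have m: "0 < m" using pos y by (simp add: m_def)
  have le: "s l \<le> ereal (k l + m)" if l: "l \<in> S" for l
  proof (cases "l \<in> K")
    case True
    then show ?thesis using c(2)[OF True] y fin[OF l] by (cases "s l") (auto simp: m_def)
  next
    case False
    with out[of l] l have "s l \<le> ereal (k l)" by simp
    also have "\<dots> \<le> ereal (k l + m)" using m by simp
    finally show ?thesis .
  qed
  obtain r where r: "0 < r" "cball c r \<subseteq> S" using op cS open_contains_cball by blast
  have ckr: "continuous_on (sphere c r) k"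
    by (rule continuous_on_subset[OF ck]) (use r in auto)
  have "s c \<le> circle_mean s c r" using sub r by (simp add: subharmonic_on_def)
  also have "\<dots> \<le> circle_mean (\<lambda>l. ereal (k l + m)) c r"
    using r by (intro circle_mean_mono le) auto
  also have "\<dots> = ereal (real_circle_mean (\<lambda>l. k l + m) c r)"
    using r by (intro circle_mean_real continuous_intros ckr) auto
  also have "real_circle_mean (\<lambda>l. k l + m) c r = real_circle_mean k c r + m"
    using r by (subst real_circle_mean_add) (auto simp: real_circle_mean_const intro!: ckr)
  finally have "y \<le> real_circle_mean k c r + m" using y by simp
  with strict[OF r] show False by (simp add: m_def)
qed

text \<open>
The real part of this map is the Poisson kernel of the unit disc with pole at \<open>1\<close>.
\<close>
definition cayley :: "complex \<Rightarrow> complex" where "cayley l = (1 + l) / (1 - l)"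

lemma Re_cayley: "Re (cayley l) = (1 - (cmod l)\<^sup>2) / (cmod (1 - l))\<^sup>2"
  by (simp add: cayley_def Re_divide cmod_power2) (simp add: power2_eq_square algebra_simps)

lemma Re_cayley_pos: "cmod l < 1 \<Longrightarrow> 0 < Re (cayley l)"
proof -
  assume l: "cmod l < 1"
  then have "l \<noteq> 1" by auto
  moreover have "(cmod l)\<^sup>2 < 1" using l by (simp add: power_less_one_iff)
  ultimately show ?thesis by (simp add: Re_cayley)
qed

lemma real_circle_mean_norm_square:
  assumes "0 < r"
  shows "real_circle_mean (\<lambda>l. (cmod l)\<^sup>2) c r = (cmod c)\<^sup>2 + r\<^sup>2"
proof -
  define f where "f l = of_real ((cmod c)\<^sup>2 + r\<^sup>2) + 2 * cnj c * (l - c)" for l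
  have "real_circle_mean (\<lambda>l. (cmod l)\<^sup>2) c r = real_circle_mean (\<lambda>l. Re (f l)) c r"
  proof (rule real_circle_mean_cong)
    fix l assume "l \<in> sphere c r"
    then have r2: "r\<^sup>2 = (cmod (l - c))\<^sup>2" by (simp add: dist_norm norm_minus_commute)
    show "(cmod l)\<^sup>2 = Re (f l)"
      unfolding f_def r2 cmod_power2 by (simp add: power2_eq_square algebra_simps)
  qed (use assms in simp)
  also have "\<dots> = Re (f c)"
    by (rule real_circle_mean_Re_holomorphic[OF _ assms]) (auto simp: f_def intro!: holomorphic_intros)
  finally show ?thesis by (simp add: f_def)
qed

text \<open>
The Poisson kernel is a singular positive harmonic function: its boundary values vanish except at the
pole \<open>1\<close>, and an upper bound on \<open>s\<close> excludes the growth that is needed to profit from the pole. As in the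
Phragmen-Lindelof principle, \<open>s\<close> is compared with a small multiple of \<open>ln (2 / cmod (1 - l))\<close>, which
exceeds the bound \<open>M\<close> near \<open>1\<close>.
\<close>
lemma subharmonic_below_poisson_kernel_nonpos:
  assumes sub: "subharmonic_on (ball 0 1) s"
    and M: "\<And>l. l \<in> ball 0 1 \<Longrightarrow> s l \<le> ereal M"
    and P: "\<And>l. l \<in> ball 0 1 \<Longrightarrow> s l \<le> ereal (Re (cayley l))"
    and l0: "l0 \<in> ball 0 1"
  shows "s l0 \<le> 0"
proof -
  define C where "C = (ln 2 - ln (cmod (1 - l0))) + (2 - (cmod l0)\<^sup>2)"
  have lt2: "0 < cmod (1 - l)" "cmod (1 - l) \<le> 2" "(cmod l)\<^sup>2 \<le> 1" if "l \<in> ball 0 1" for l :: complex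
  proof -
    have l: "cmod l < 1" using that by simp
    then show "0 < cmod (1 - l)" by auto
    show "cmod (1 - l) \<le> 2" using norm_triangle_ineq4[of 1 l] l by simp
    show "(cmod l)\<^sup>2 \<le> 1" using l by (simp add: power_le_one)
  qed
  have lnnn: "0 \<le> ln 2 - ln (cmod (1 - l))" if "l \<in> ball 0 1" for l
    using ln_mono[OF lt2(2)[OF that] lt2(1)[OF that]] by simp
  have main: "s l0 \<le> ereal (t * C)" if t: "0 < t" for t
  proof -
    \<comment> \<open>The term \<open>- t * (cmod l)\<^sup>2\<close> makes the mean value inequality strict; the constant \<open>2 * t\<close> keeps
      \<open>k \<ge> t\<close>, so that there is room above the Poisson kernel near the rest of the circle.\<close>
    define k where "k l = (t * ln 2 + 2 * t) + (- t * ln (cmod (1 - l)) + - t * (cmod l)\<^sup>2)" for l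
    have k: "k l = t * (ln 2 - ln (cmod (1 - l))) + t * (2 - (cmod l)\<^sup>2)" for l
      by (simp add: k_def algebra_simps)
    have t2: "t \<le> t * (2 - (cmod l)\<^sup>2)" if "l \<in> ball 0 1" for l :: complex
      using mult_left_mono[of 1 "2 - (cmod l)\<^sup>2" t] lt2(3)[OF that] t by simp
    have tln: "0 \<le> t * (ln 2 - ln (cmod (1 - l)))" if "l \<in> ball 0 1" for l
      using lnnn[OF that] t by simp
    have cln: "continuous_on A (\<lambda>l. ln (cmod (1 - l)))" if "A \<subseteq> ball 0 1" for A
      using lt2(1) that by (intro continuous_intros) force
    have ck: "continuous_on A k" if "A \<subseteq> ball 0 1" for A
      unfolding k_def by (intro continuous_intros cln that)
    \<comment> \<open>Within distance \<open>d\<close> of the pole the logarithm exceeds \<open>M\<close>; elsewhere the Poisson kernel is at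
      most \<open>t\<close> once \<open>cmod l > R\<close>.\<close>
    define d where "d = 2 * exp (- M / t)"
    have d: "0 < d" by (simp add: d_def)
    define R where "R = sqrt (max 0 (1 - t * d\<^sup>2))"
    have R: "0 \<le> R" "R < 1" "1 - R\<^sup>2 \<le> t * d\<^sup>2"
      using t d by (auto simp: R_def max_def)
    have "s l0 \<le> ereal (k l0)"
    proof (rule subharmonic_le_strict_superharmonic[OF sub open_ball _ _ ck])
      show "compact (cball (0::complex) R)" by simp
      show "cball (0::complex) R \<subseteq> ball 0 1" using R by auto
      fix c :: complex and r :: real assume r: "0 < r" and cr: "cball c r \<subseteq> ball 0 1"
      have sp: "sphere c r \<subseteq> ball 0 1" using cr by auto
      have "1 \<notin> cball c r" using cr by auto
      then have "cmod (- 1) * r < cmod (1 - c)" by (simp add: dist_norm norm_minus_commute)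
      from real_circle_mean_ln_nonvanishing[OF r this, of c]
      have ml: "real_circle_mean (\<lambda>l. ln (cmod (1 - l))) c r = ln (cmod (1 - c))"
        by (simp add: algebra_simps)
      have "real_circle_mean k c r = (t * ln 2 + 2 * t) + (- t * ln (cmod (1 - c)) + - t * ((cmod c)\<^sup>2 + r\<^sup>2))"
        unfolding k_def using r
        by (subst real_circle_mean_add, (intro continuous_intros cln sp)+, simp,
            subst real_circle_mean_add, (intro continuous_intros cln sp)+, simp,
            simp only: real_circle_mean_const real_circle_mean_cmult ml real_circle_mean_norm_square[OF r])
      also have "\<dots> < k c" unfolding k_def using t r by simp
      finally show "real_circle_mean k c r < k c" .
    next
      fix l :: complex assume l: "l \<in> ball 0 1 - cball 0 R"
      then have lb: "l \<in> ball 0 1" by simp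
      show "s l \<le> ereal (k l)"
      proof (cases "cmod (1 - l) \<le> d")
        case True
        have "ln (cmod (1 - l)) \<le> ln d" by (rule ln_mono[OF True lt2(1)[OF lb]])
        also have "ln d = ln 2 - M / t" by (simp add: d_def ln_mult)
        finally have "M \<le> t * (ln 2 - ln (cmod (1 - l)))" using t by (simp add: field_simps)
        then have "M \<le> k l" unfolding k using t2[OF lb] t by linarith
        then show ?thesis using M[OF lb] by (meson ereal_less_eq(3) order_trans)
      next
        case False
        have "R < cmod l" using l by simp
        then have "R\<^sup>2 < (cmod l)\<^sup>2" using R by (intro power_strict_mono) auto
        then have "1 - (cmod l)\<^sup>2 \<le> t * d\<^sup>2" using R by linarith
        also have "\<dots> \<le> t * (cmod (1 - l))\<^sup>2"
          using False d t by (intro mult_left_mono power_mono) auto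
        finally have "Re (cayley l) \<le> t"
          unfolding Re_cayley using lt2(1)[OF lb] by (simp add: field_simps)
        then have "Re (cayley l) \<le> k l" unfolding k using t2[OF lb] tln[OF lb] by linarith
        then show ?thesis using P[OF lb] by (meson ereal_less_eq(3) order_trans)
      qed
    qed (use l0 in auto)
    then show ?thesis by (simp add: k C_def algebra_simps)
  qed
  have C: "0 < C" using lnnn[OF l0] lt2(3)[OF l0] by (simp add: C_def)
  show ?thesis
  proof (cases "s l0")
    case (real y)
    have "y \<le> 0 + e" if "0 < e" for e
      using main[of "e / C"] C that real by simp
    then have "y \<le> 0" by (rule field_le_epsilon)
    then show ?thesis using real by simp
  qed (use main[of 1] in auto)
qed

section \<open>Pluriharmonic functions of one coordinate\<close>

text \<open>
The derivatives of \<open>Re (g (x $ j))\<close> are bounded linear images \<open>b\<close> and \<open>B\<close> of \<open>g'\<close> and \<open>g''\<close>, which gives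
their differentiability and continuity; replacing \<open>w\<close> by \<open>\<i> w\<close> multiplies the second derivative by \<open>\<i>\<^sup>2 = -1\<close>.
\<close>
lemma pluriharmonic_on_Re_coordinate:
  fixes \<Omega> :: "(complex^'n) set"
  assumes hol: "g holomorphic_on S" and op: "open S" and sub: "\<And>x. x \<in> \<Omega> \<Longrightarrow> x $ j \<in> S"
  shows "pluriharmonic_on \<Omega> (\<lambda>x. Re (g (x $ j)))"
proof -
  define P :: "(complex^'n) \<Rightarrow>\<^sub>L complex" where "P = Blinfun (\<lambda>v. v $ j)"
  define R :: "complex \<Rightarrow>\<^sub>L real" where "R = Blinfun Re"
  have P: "blinfun_apply P v = v $ j" for v
    unfolding P_def by (subst bounded_linear_Blinfun_apply) (auto intro: bounded_linear_vec_nth)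
  have R: "blinfun_apply R a = Re a" for a
    unfolding R_def by (subst bounded_linear_Blinfun_apply) (auto intro: bounded_linear_Re)
  define b where "b a = R o\<^sub>L (blinfun_mult_right a o\<^sub>L P)" for a
  have bl: "bounded_linear b"
    unfolding b_def
    by (intro bounded_linear_compose[OF bounded_bilinear.bounded_linear_right[OF bounded_bilinear_blinfun_compose]]
        bounded_linear_compose[OF bounded_bilinear.bounded_linear_left[OF bounded_bilinear_blinfun_compose]]
        bounded_linear_blinfun_mult_right)
  define B where "B = Blinfun b"
  have B: "blinfun_apply B a = b a" for a
    unfolding B_def by (subst bounded_linear_Blinfun_apply) (auto intro: bl)
  define D where "D x = b (deriv g (x $ j))" for x :: "complex^'n"
  define D2 where "D2 x = B o\<^sub>L (blinfun_mult_right (deriv (deriv g) (x $ j)) o\<^sub>L P)" for x :: "complex^'n"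
  have hol1: "deriv g holomorphic_on S" by (rule holomorphic_deriv[OF hol op])
  have hol2: "deriv (deriv g) holomorphic_on S" by (rule holomorphic_deriv[OF hol1 op])
  have chain: "((\<lambda>x. f (x $ j)) has_derivative (\<lambda>v. deriv f (x $ j) * v $ j)) (at x)"
    if f: "f holomorphic_on S" and x: "x \<in> \<Omega>" for f and x :: "complex^'n"
  proof -
    have "(f has_field_derivative deriv f (x $ j)) (at (x $ j))"
      by (rule holomorphic_derivI[OF f op sub[OF x]])
    then have "(f has_derivative (\<lambda>h. deriv f (x $ j) * h)) (at (x $ j))"
      by (simp add: has_field_derivative_def)
    from has_derivative_compose[OF bounded_linear.has_derivative[OF bounded_linear_vec_nth has_derivative_ident] this]
    show ?thesis .
  qed
  show ?thesis
    unfolding pluriharmonic_on_def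
  proof (intro exI conjI ballI allI)
    fix x assume x: "x \<in> \<Omega>"
    have "((\<lambda>x. Re (g (x $ j))) has_derivative (\<lambda>v. Re (deriv g (x $ j) * v $ j))) (at x)"
      by (rule bounded_linear.has_derivative[OF bounded_linear_Re chain[OF hol x]])
    moreover have "blinfun_apply (D x) = (\<lambda>v. Re (deriv g (x $ j) * v $ j))"
      by (simp add: fun_eq_iff D_def b_def R P)
    ultimately show "((\<lambda>x. Re (g (x $ j))) has_derivative blinfun_apply (D x)) (at x)" by simp
    have "(D has_derivative (\<lambda>v. b (deriv (deriv g) (x $ j) * v $ j))) (at x)"
      unfolding D_def[abs_def] by (rule bounded_linear.has_derivative[OF bl chain[OF hol1 x]])
    moreover have "blinfun_apply (D2 x) = (\<lambda>v. b (deriv (deriv g) (x $ j) * v $ j))"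
      by (simp add: fun_eq_iff D2_def B P)
    ultimately show "(D has_derivative blinfun_apply (D2 x)) (at x)" by simp
    fix w
    show "blinfun_apply (blinfun_apply (D2 x) w) w +
        blinfun_apply (blinfun_apply (D2 x) (\<i> *s w)) (\<i> *s w) = 0"
      by (simp add: D2_def B P b_def R algebra_simps)
  next
    have "continuous_on \<Omega> (\<lambda>x. deriv (deriv g) (x $ j))"
      by (rule continuous_on_compose2[OF holomorphic_on_imp_continuous_on[OF hol2]])
        (auto intro!: continuous_intros sub)
    from bounded_linear.continuous_on[OF bounded_linear_blinfun_mult_right this]
    show "continuous_on \<Omega> D2"
      unfolding D2_def[abs_def]
      by (intro bounded_bilinear.continuous_on[OF bounded_bilinear_blinfun_compose] continuous_on_const)
  qed
qed

section \<open>The Hartogs domain\<close>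

text \<open>
The pluriharmonic function of the theorem: the Poisson kernel of the second coordinate.
\<close>
definition poisson_pot :: "complex^2 \<Rightarrow> real" where "poisson_pot x = Re (cayley (x $ 2))"

text \<open>
Over a point \<open>w\<close> of the unit disc the fibre of this Hartogs domain is a disc of radius less than \<open>exp (- P\<^sup>2 / 2)\<close>,
where \<open>P\<close> is the Poisson kernel at \<open>w\<close>, so that \<open>P\<^sup>2 < - 2 ln |z|\<close> on the domain. The summand \<open>1\<close> next
to the exponential contributes \<open>|z|\<^sup>2\<close> and hence strict plurisubharmonicity in the direction of
the fibre; the term in \<open>|w|\<^sup>2\<close> contributes it in the other direction and collapses
the fibres over the unit circle to points.
\<close>
definition cusp_domain :: "(complex^2) set" where
  "cusp_domain = {x. cmod (x $ 2) < 1 \<and>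
     (cmod (x $ 1))\<^sup>2 * (1 + exp ((poisson_pot x)\<^sup>2)) + (cmod (x $ 2))\<^sup>2 < 1}"

definition cusp_disc :: "(complex^2) set" where
  "cusp_disc = {x. x $ 1 = 0 \<and> cmod (x $ 2) < 1}"

lemma norm_square_vec2: "(norm (x :: complex^2))\<^sup>2 = (cmod (x $ 1))\<^sup>2 + (cmod (x $ 2))\<^sup>2"
  unfolding power2_norm_eq_inner inner_vec_def sum_2 by simp

lemma holomorphic_cayley: "cayley holomorphic_on ball 0 1"
  unfolding cayley_def by (intro holomorphic_intros) auto

lemma continuous_on_cayley_coordinate:
  "continuous_on {x :: complex^2. cmod (x $ 2) < 1} (\<lambda>x. cayley (x $ 2))"
  by (rule continuous_on_compose2[OF holomorphic_on_imp_continuous_on[OF holomorphic_cayley]])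
    (auto intro!: continuous_intros)

lemma continuous_on_poisson_pot: "continuous_on {x. cmod (x $ 2) < 1} poisson_pot"
  unfolding poisson_pot_def[abs_def] by (intro continuous_intros continuous_on_cayley_coordinate)

lemma cusp_domain_cylinder: "x \<in> cusp_domain \<Longrightarrow> cmod (x $ 2) < 1"
  by (simp add: cusp_domain_def)

lemma cusp_domain_subset_cylinder: "cusp_domain \<subseteq> {x. cmod (x $ 2) < 1}"
  by (auto simp: cusp_domain_def)

lemma cusp_domain_fibre: "x \<in> cusp_domain \<Longrightarrow> (cmod (x $ 1))\<^sup>2 * exp ((poisson_pot x)\<^sup>2) < 1"
proof -
  assume "x \<in> cusp_domain"
  then have "(cmod (x $ 1))\<^sup>2 * (1 + exp ((poisson_pot x)\<^sup>2)) + (cmod (x $ 2))\<^sup>2 < 1"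
    by (simp add: cusp_domain_def)
  then show ?thesis
    using zero_le_power2[of "cmod (x $ 1)"] zero_le_power2[of "cmod (x $ 2)"]
    unfolding distrib_left mult_1_right by linarith
qed

lemma norm_less_1_cusp_domain: "x \<in> cusp_domain \<Longrightarrow> norm x < 1"
proof -
  assume "x \<in> cusp_domain"
  then have "(cmod (x $ 1))\<^sup>2 * (1 + exp ((poisson_pot x)\<^sup>2)) + (cmod (x $ 2))\<^sup>2 < 1"
    by (simp add: cusp_domain_def)
  moreover have "0 \<le> (cmod (x $ 1))\<^sup>2 * exp ((poisson_pot x)\<^sup>2)" by simp
  ultimately have "(norm x)\<^sup>2 < 1\<^sup>2"
    unfolding norm_square_vec2 distrib_left mult_1_right one_power2 by linarith
  then show ?thesis by (rule power_less_imp_less_base) simp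
qed

lemma continuous_on_defining_function:
  "continuous_on {x. cmod (x $ 2) < 1}
    (\<lambda>x. (cmod (x $ 1))\<^sup>2 * (1 + exp ((poisson_pot x)\<^sup>2)) + (cmod (x $ 2))\<^sup>2 - 1)"
  by (intro continuous_intros continuous_on_poisson_pot)

lemma open_cylinder: "open {x :: complex^2. cmod (x $ 2) < 1}"
  by (intro open_Collect_less continuous_intros)

lemma open_cusp_domain: "open cusp_domain"
proof -
  have "open ((\<lambda>x. (cmod (x $ 1))\<^sup>2 * (1 + exp ((poisson_pot x)\<^sup>2)) + (cmod (x $ 2))\<^sup>2 - 1) -` {..<0}
      \<inter> {x. cmod (x $ 2) < 1})"
    using continuous_on_open_vimage[OF open_cylinder] continuous_on_defining_function open_lessThan by blast
  moreover have "(\<lambda>x. (cmod (x $ 1))\<^sup>2 * (1 + exp ((poisson_pot x)\<^sup>2)) + (cmod (x $ 2))\<^sup>2 - 1) -` {..<0}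
      \<inter> {x. cmod (x $ 2) < 1} = cusp_domain"
    by (auto simp: cusp_domain_def)
  ultimately show ?thesis by simp
qed

lemma cusp_disc_subset: "cusp_disc \<subseteq> cusp_domain"
  by (auto simp: cusp_disc_def cusp_domain_def power_less_one_iff)

text \<open>
Rescaling the fibres maps the unit ball continuously onto the domain.
\<close>
lemma connected_cusp_domain: "connected cusp_domain"
proof -
  define \<theta> where "\<theta> x = sqrt (1 + exp ((poisson_pot x)\<^sup>2))" for x
  have \<theta>: "0 < \<theta> x" "(\<theta> x)\<^sup>2 = 1 + exp ((poisson_pot x)\<^sup>2)" for x
    by (simp_all add: \<theta>_def add_pos_pos add_nonneg_nonneg)
  define f :: "complex^2 \<Rightarrow> complex^2" where
    "f x = (\<chi> i. if i = 1 then x $ 1 / of_real (\<theta> x) else x $ 2)" for x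
  have f1: "f x $ 1 = x $ 1 / of_real (\<theta> x)" and f2: "f x $ 2 = x $ 2" for x
    by (simp_all add: f_def)
  have Wf: "poisson_pot (f x) = poisson_pot x" "\<theta> (f x) = \<theta> x" for x by (simp_all add: poisson_pot_def \<theta>_def f2)
  have ball: "ball 0 1 \<subseteq> {x :: complex^2. cmod (x $ 2) < 1}"
    using Finite_Cartesian_Product.norm_nth_le by (force intro: le_less_trans)
  have cW: "continuous_on (ball 0 1) poisson_pot" by (rule continuous_on_subset[OF continuous_on_poisson_pot ball])
  have c\<theta>: "continuous_on (ball 0 1) \<theta>" unfolding \<theta>_def[abs_def] by (intro continuous_intros cW)
  have "continuous_on (ball 0 1) f"
    unfolding f_def[abs_def]
  proof (rule continuous_on_vec_lambda)
    fix i :: 2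
    show "continuous_on (ball 0 1) (\<lambda>x. if i = 1 then x $ 1 / complex_of_real (\<theta> x) else x $ 2)"
      using \<theta>(1) by (cases "i = 1") (auto intro!: continuous_intros c\<theta> simp: less_imp_neq[symmetric])
  qed
  then have conn: "connected (f ` ball 0 1)" by (rule connected_continuous_image) simp
  have key: "(cmod (f x $ 1))\<^sup>2 * (1 + exp ((poisson_pot (f x))\<^sup>2)) = (cmod (x $ 1))\<^sup>2" for x
    using \<theta>(1)[of x] unfolding Wf f1 \<theta>(2)[symmetric] by (simp add: norm_divide power_divide)
  have "f ` ball 0 1 = cusp_domain"
  proof (intro equalityI subsetI)
    fix y assume "y \<in> f ` ball 0 1"
    then obtain x where y: "y = f x" and x: "x \<in> ball 0 1" by blast
    have "(norm x)\<^sup>2 < 1" using x by (simp add: power_less_one_iff)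
    moreover have "cmod (x $ 2) < 1" using x ball by blast
    ultimately show "y \<in> cusp_domain"
      unfolding cusp_domain_def y mem_Collect_eq key f2 norm_square_vec2 by simp
  next
    fix y assume y: "y \<in> cusp_domain"
    define x :: "complex^2" where "x = (\<chi> i. if i = 1 then y $ 1 * of_real (\<theta> y) else y $ 2)"
    have x1: "x $ 1 = y $ 1 * of_real (\<theta> y)" and x2: "x $ 2 = y $ 2" by (simp_all add: x_def)
    have "\<theta> x = \<theta> y" by (simp add: \<theta>_def poisson_pot_def x2)
    then have "f x = y"
      using \<theta>(1)[of y] by (simp add: vec_eq_iff forall_2 f1 f2 x1 x2)
    moreover from this key[of x] y have "(norm x)\<^sup>2 < 1"
      unfolding norm_square_vec2 x2 by (simp add: cusp_domain_def)
    then have "x \<in> ball 0 1" by (simp add: power_less_one_iff)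
    ultimately show "y \<in> f ` ball 0 1" by blast
  qed
  with conn show ?thesis by simp
qed

lemma bounded_domain_cusp_domain: "bounded_domain cusp_domain"
  unfolding bounded_domain_def
proof (intro conjI open_cusp_domain connected_cusp_domain)
  have "(0 :: complex^2) \<in> cusp_disc" by (simp add: cusp_disc_def)
  then show "cusp_domain \<noteq> {}" using cusp_disc_subset by blast
  show "bounded cusp_domain"
    unfolding bounded_iff using norm_less_1_cusp_domain less_imp_le by blast
qed

lemma holomorphic_along_lines_coordinate:
  fixes \<Omega> :: "(complex^'n) set"
  assumes "g holomorphic_on S" "\<And>x. x \<in> \<Omega> \<Longrightarrow> x $ j \<in> S"
  shows "(\<lambda>l. g ((a + l *s w) $ j)) holomorphic_on {l. a + l *s w \<in> \<Omega>}"
proof -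
  have "(\<lambda>l. (a + l *s w) $ j) holomorphic_on {l. a + l *s w \<in> \<Omega>}"
    by (simp, intro holomorphic_intros)
  moreover have "(\<lambda>l. (a + l *s w) $ j) ` {l. a + l *s w \<in> \<Omega>} \<subseteq> S"
    using assms(2) by blast
  ultimately show ?thesis
    using holomorphic_on_compose_gen[OF _ assms(1)] unfolding o_def by blast
qed

lemma cayley_along_lines:
  "(\<lambda>l. cayley ((a + l *s w) $ 2)) holomorphic_on {l. a + l *s w \<in> cusp_domain}"
  by (rule holomorphic_along_lines_coordinate[OF holomorphic_cayley]) (simp add: cusp_domain_cylinder)

lemma continuous_on_cayley_cusp: "continuous_on cusp_domain (\<lambda>x. cayley (x $ 2))"
  by (rule continuous_on_subset[OF continuous_on_cayley_coordinate cusp_domain_subset_cylinder])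

lemma continuous_on_poisson_pot_cusp: "continuous_on cusp_domain poisson_pot"
  by (rule continuous_on_subset[OF continuous_on_poisson_pot cusp_domain_subset_cylinder])

text \<open>
From \<open>P\<^sup>2 = sup\<^sub>s (2 s P - s\<^sup>2)\<close> one gets \<open>|z|\<^sup>2 exp (P\<^sup>2)\<close> as the supremum over real \<open>s\<close> of the moduli of
the holomorphic functions \<open>z\<^sup>2 exp (2 s C - s\<^sup>2)\<close>, where \<open>P = Re C\<close>. A modulus in turn is the supremum of
the real parts of the rotated functions. At a given point \<open>x\<close> the supremum is attained for
\<open>s = P x\<close> and the rotation \<open>\<eta>\<close> that makes the value positive.
\<close>
lemma psh_on_square_exp_square:
  "psh_on cusp_domain (\<lambda>x. ereal ((cmod (x $ 1))\<^sup>2 * exp ((poisson_pot x)\<^sup>2)))"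
proof (rule psh_on_supremum)
  show "continuous_on cusp_domain (\<lambda>x. (cmod (x $ 1))\<^sup>2 * exp ((poisson_pot x)\<^sup>2))"
    by (intro continuous_intros continuous_on_poisson_pot_cusp)
  fix x and e :: real assume x: "x \<in> cusp_domain" and e: "0 < e"
  define s where "s = poisson_pot x"
  define E where "E y = (y $ 1)\<^sup>2 * exp (of_real (2 * s) * cayley (y $ 2) - of_real (s\<^sup>2))" for y :: "complex^2"
  have normE: "cmod (E y) = (cmod (y $ 1))\<^sup>2 * exp (2 * s * poisson_pot y - s\<^sup>2)" for y
    by (simp add: E_def norm_mult norm_power poisson_pot_def)
  define \<eta> where "\<eta> = cnj (sgn (E x))"
  have \<eta>: "cmod \<eta> \<le> 1" by (simp add: \<eta>_def norm_sgn)
  define \<Phi> where "\<Phi> y = \<eta> * E y" for y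
  have "psh_on cusp_domain (\<lambda>y. ereal (Re (\<Phi> y)))"
  proof (rule psh_on_Re_holomorphic)
    show "continuous_on cusp_domain \<Phi>"
      unfolding \<Phi>_def[abs_def] E_def by (intro continuous_intros continuous_on_cayley_cusp)
    fix a w :: "complex^2"
    show "(\<lambda>l. \<Phi> (a + l *s w)) holomorphic_on {l. a + l *s w \<in> cusp_domain}"
      unfolding \<Phi>_def E_def
      by (intro holomorphic_intros cayley_along_lines holomorphic_along_lines_coordinate[of "\<lambda>l. l" UNIV]) auto
  qed
  moreover have "Re (\<Phi> y) \<le> (cmod (y $ 1))\<^sup>2 * exp ((poisson_pot y)\<^sup>2)" for y
  proof -
    have "Re (\<Phi> y) \<le> cmod \<eta> * cmod (E y)"
      using complex_Re_le_cmod[of "\<Phi> y"] by (simp add: \<Phi>_def norm_mult)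
    also have "\<dots> \<le> cmod (E y)" using \<eta> by (simp add: mult_left_le_one_le)
    also have "\<dots> \<le> (cmod (y $ 1))\<^sup>2 * exp ((poisson_pot y)\<^sup>2)"
    proof -
      have "2 * s * poisson_pot y - s\<^sup>2 \<le> (poisson_pot y)\<^sup>2"
        using zero_le_power2[of "poisson_pot y - s"] by (simp add: power2_diff algebra_simps)
      then show ?thesis unfolding normE by (intro mult_left_mono) auto
    qed
    finally show ?thesis .
  qed
  moreover have "Re (\<Phi> x) = (cmod (x $ 1))\<^sup>2 * exp ((poisson_pot x)\<^sup>2)"
  proof -
    have "\<Phi> x = of_real (cmod (E x))"
    proof (cases "E x = 0")
      case False
      have "\<Phi> x = (E x * cnj (E x)) / of_real (cmod (E x))"
        by (simp add: \<Phi>_def \<eta>_def sgn_div_norm scaleR_conv_of_real field_simps)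
      also have "\<dots> = of_real (cmod (E x))"
        using False by (simp only: complex_norm_square[symmetric]) (simp add: power2_eq_square)
      finally show ?thesis .
    qed (simp add: \<Phi>_def)
    then show ?thesis by (simp add: normE) (simp add: s_def power2_eq_square)
  qed
  ultimately show "\<exists>v. psh_on cusp_domain v \<and> (\<forall>y\<in>cusp_domain. v y \<le> ereal ((cmod (y $ 1))\<^sup>2 * exp ((poisson_pot y)\<^sup>2))) \<and>
      ereal ((cmod (x $ 1))\<^sup>2 * exp ((poisson_pot x)\<^sup>2) - e) \<le> v x"
    using e by (intro exI[of _ "\<lambda>y. ereal (Re (\<Phi> y))"]) auto
qed

section \<open>B-regularity of the Hartogs domain\<close>

text \<open>
The value \<open>0\<close> outside the cylinder over the unit disc is the boundary value over the unit circle.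
\<close>
definition cusp_exhaustion :: "complex^2 \<Rightarrow> real" where
  "cusp_exhaustion x = (if cmod (x $ 2) < 1
     then (cmod (x $ 1))\<^sup>2 * (1 + exp ((poisson_pot x)\<^sup>2)) + (cmod (x $ 2))\<^sup>2 - 1 else 0)"

lemma cusp_exhaustion_eq:
  "cmod (x $ 2) < 1 \<Longrightarrow>
    cusp_exhaustion x = (cmod (x $ 1))\<^sup>2 * (1 + exp ((poisson_pot x)\<^sup>2)) + (cmod (x $ 2))\<^sup>2 - 1"
  by (simp add: cusp_exhaustion_def)

lemma cusp_domain_iff: "x \<in> cusp_domain \<longleftrightarrow> cusp_exhaustion x < 0"
  by (auto simp: cusp_exhaustion_def cusp_domain_def)

lemma cusp_exhaustion_ge:
  assumes "cmod (x $ 2) \<le> 1"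
  shows "(cmod (x $ 2))\<^sup>2 - 1 \<le> cusp_exhaustion x"
proof (cases "cmod (x $ 2) < 1")
  case True
  have "0 \<le> (cmod (x $ 1))\<^sup>2 * (1 + exp ((poisson_pot x)\<^sup>2))" by (simp add: add_nonneg_nonneg)
  then show ?thesis unfolding cusp_exhaustion_eq[OF True] by linarith
next
  case False
  then show ?thesis using assms by (simp add: cusp_exhaustion_def)
qed

lemma continuous_on_cusp_exhaustion_cylinder:
  "continuous_on {x. cmod (x $ 2) < 1} cusp_exhaustion"
proof -
  have "continuous_on {x. cmod (x $ 2) < 1} cusp_exhaustion \<longleftrightarrow> continuous_on {x. cmod (x $ 2) < 1}
    (\<lambda>x. (cmod (x $ 1))\<^sup>2 * (1 + exp ((poisson_pot x)\<^sup>2)) + (cmod (x $ 2))\<^sup>2 - 1)"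
    by (rule continuous_on_cong) (auto simp: cusp_exhaustion_eq)
  with continuous_on_defining_function show ?thesis by simp
qed

lemma closure_cusp_domain_cylinder:
  assumes "x \<in> closure cusp_domain"
  shows "cmod (x $ 2) \<le> 1"
proof -
  have "closed {x :: complex^2. cmod (x $ 2) \<le> 1}"
    by (intro closed_Collect_le continuous_intros)
  then have "closure cusp_domain \<subseteq> {x. cmod (x $ 2) \<le> 1}"
    using cusp_domain_cylinder by (intro closure_minimal) (auto intro: less_imp_le)
  then show ?thesis using assms by blast
qed

lemma cusp_exhaustion_nonpos_closure:
  assumes x: "x \<in> closure cusp_domain"
  shows "cusp_exhaustion x \<le> 0"
proof (rule ccontr)
  assume pos: "\<not> ?thesis"
  then have x2: "cmod (x $ 2) < 1" by (auto simp: cusp_exhaustion_def split: if_splits)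
  have "open (cusp_exhaustion -` {0<..} \<inter> {x. cmod (x $ 2) < 1})"
    using continuous_on_open_vimage[OF open_cylinder] continuous_on_cusp_exhaustion_cylinder open_greaterThan by blast
  moreover have "x \<in> cusp_exhaustion -` {0<..} \<inter> {x. cmod (x $ 2) < 1}" using pos x2 by simp
  ultimately have "(cusp_exhaustion -` {0<..} \<inter> {x. cmod (x $ 2) < 1}) \<inter> cusp_domain \<noteq> {}"
    using x open_Int_closure_eq_empty by blast
  then show False by (auto simp: cusp_domain_iff)
qed

text \<open>
Continuity is at stake only over the unit circle, where the exponential may blow up. There the
defining function is squeezed on the closure of the domain: it is at most \<open>0\<close>, and at least \<open>|w|\<^sup>2 - 1\<close>,
because the other summand is nonnegative.
\<close>
lemma continuous_on_cusp_exhaustion: "continuous_on (closure cusp_domain) cusp_exhaustion"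
  unfolding continuous_on_def
proof
  fix x assume x: "x \<in> closure cusp_domain"
  show "(cusp_exhaustion \<longlongrightarrow> cusp_exhaustion x) (at x within closure cusp_domain)"
  proof (cases "cmod (x $ 2) < 1")
    case True
    then have "isCont cusp_exhaustion x"
      using continuous_on_cusp_exhaustion_cylinder open_cylinder by (simp add: continuous_on_eq_continuous_at)
    then show ?thesis unfolding isCont_def by (rule tendsto_within_subset) simp
  next
    case False
    then have one: "cmod (x $ 2) = 1" using closure_cusp_domain_cylinder[OF x] by simp
    have inK: "\<forall>\<^sub>F y in at x within closure cusp_domain. y \<in> closure cusp_domain"
      by (simp add: eventually_at_filter)
    have "((\<lambda>y. (cmod (y $ 2))\<^sup>2 - 1) \<longlongrightarrow> (cmod (x $ 2))\<^sup>2 - 1) (at x within closure cusp_domain)"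
      by (intro tendsto_intros)
    then have lower: "((\<lambda>y. (cmod (y $ 2))\<^sup>2 - 1) \<longlongrightarrow> 0) (at x within closure cusp_domain)"
      by (simp add: one)
    have "(cusp_exhaustion \<longlongrightarrow> 0) (at x within closure cusp_domain)"
    proof (rule tendsto_sandwich[OF _ _ lower tendsto_const])
      show "\<forall>\<^sub>F y in at x within closure cusp_domain. (cmod (y $ 2))\<^sup>2 - 1 \<le> cusp_exhaustion y"
        using inK by eventually_elim (intro cusp_exhaustion_ge closure_cusp_domain_cylinder)
      show "\<forall>\<^sub>F y in at x within closure cusp_domain. cusp_exhaustion y \<le> 0"
        using inK by eventually_elim (rule cusp_exhaustion_nonpos_closure)
    qed
    then show ?thesis using False by (simp add: cusp_exhaustion_def)
  qed
qed

lemma B_regular_cusp_domain: "B_regular cusp_domain"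
proof (rule B_regular_if_strict_psh_exhaustion[OF bounded_domain_cusp_domain continuous_on_cusp_exhaustion])
  show "cusp_exhaustion x = 0" if "x \<in> frontier cusp_domain" for x
  proof -
    have "x \<in> closure cusp_domain" "x \<notin> cusp_domain"
      using that open_cusp_domain by (auto simp: frontier_def interior_open)
    then show ?thesis using cusp_exhaustion_nonpos_closure[of x] by (simp add: cusp_domain_iff)
  qed
  show "cusp_exhaustion x < 0" if "x \<in> cusp_domain" for x using that by (simp add: cusp_domain_iff)
  let ?F = "\<lambda>x. (cmod (x $ 1))\<^sup>2 * exp ((poisson_pot x)\<^sup>2)"
  have cF: "continuous_on cusp_domain ?F"
    by (intro continuous_intros continuous_on_poisson_pot_cusp)
  have eq: "cusp_exhaustion x - (norm x)\<^sup>2 = - 1 + 1 * ?F x" if "x \<in> cusp_domain" for x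
    using cusp_domain_cylinder[OF that] by (simp add: cusp_exhaustion_eq norm_square_vec2 algebra_simps)
  have psh: "psh_on cusp_domain (\<lambda>x. ereal (- 1 + 1 * ?F x))"
    by (intro psh_on_add_scaled_real psh_on_const psh_on_square_exp_square cF continuous_on_const) simp
  show "psh_on cusp_domain (\<lambda>x. ereal (cusp_exhaustion x - (norm x)\<^sup>2))"
  proof (rule psh_on_supremum)
    show "continuous_on cusp_domain (\<lambda>x. cusp_exhaustion x - (norm x)\<^sup>2)"
      by (intro continuous_intros continuous_on_subset[OF continuous_on_cusp_exhaustion closure_subset])
    fix x and e :: real assume "x \<in> cusp_domain" "0 < e"
    then show "\<exists>v. psh_on cusp_domain v \<and> (\<forall>y\<in>cusp_domain. v y \<le> ereal (cusp_exhaustion y - (norm y)\<^sup>2)) \<and>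
        ereal (cusp_exhaustion x - (norm x)\<^sup>2 - e) \<le> v x"
      by (intro exI[of _ "\<lambda>x. ereal (- 1 + 1 * ?F x)"] conjI psh) (simp_all add: eq)
  qed
qed

section \<open>Majorants with a pole along the disc\<close>

lemma poisson_pot_pos: "x \<in> cusp_domain \<Longrightarrow> 0 < poisson_pot x"
  unfolding poisson_pot_def by (intro Re_cayley_pos cusp_domain_cylinder)

lemma ln_cusp_domain:
  assumes x: "x \<in> cusp_domain" and x1: "x $ 1 \<noteq> 0"
  shows "2 * ln (cmod (x $ 1)) + (poisson_pot x)\<^sup>2 < 0"
proof -
  have "ln ((cmod (x $ 1))\<^sup>2 * exp ((poisson_pot x)\<^sup>2)) < ln 1"
    using cusp_domain_fibre[OF x] x1 by (subst ln_less_cancel_iff) auto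
  moreover have "ln ((cmod (x $ 1))\<^sup>2 * exp ((poisson_pot x)\<^sup>2)) = 2 * ln (cmod (x $ 1)) + (poisson_pot x)\<^sup>2"
    using x1 by (simp add: ln_mult ln_realpow)
  ultimately show ?thesis by simp
qed

text \<open>
The function \<open>-2 ln |z|\<close>, with the value \<open>\<infinity>\<close> on the disc \<open>z = 0\<close>. It majorizes the square of the
Poisson kernel on the domain, which makes it a witness both for tameness and for
pluri-quasiboundedness.
\<close>
definition log_pole :: "complex^2 \<Rightarrow> ereal" where
  "log_pole x = - re_plus_log (\<lambda>_. 0) 2 1 x"

lemma log_pole_simps:
  "x $ 1 = 0 \<Longrightarrow> log_pole x = \<infinity>"
  "x $ 1 \<noteq> 0 \<Longrightarrow> log_pole x = ereal (- (2 * ln (cmod (x $ 1))))"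
  by (simp_all add: log_pole_def re_plus_log_def)

lemma psuperh_on_log_pole: "psuperh_on \<Omega> log_pole"
proof -
  have "psh_on \<Omega> (re_plus_log (\<lambda>_ :: complex^2. 0) 2 1)"
    by (rule psh_on_re_plus_log) auto
  then show ?thesis by (simp add: psuperh_on_def log_pole_def)
qed

lemma poisson_pot_square_le_log_pole: "x \<in> cusp_domain \<Longrightarrow> ereal ((poisson_pot x)\<^sup>2) \<le> log_pole x"
  using ln_cusp_domain[of x] by (cases "x $ 1 = 0") (auto simp: log_pole_simps)

lemma log_pole_pos:
  assumes "x \<in> cusp_domain"
  shows "0 < log_pole x"
proof (cases "x $ 1 = 0")
  case False
  have "0 < - (2 * ln (cmod (x $ 1)))"
    using ln_cusp_domain[OF assms False] zero_le_power2[of "poisson_pot x"] by linarith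
  then show ?thesis unfolding log_pole_simps(2)[OF False] by (simp only: ereal_less(2))
qed (simp add: log_pole_simps)

lemma log_pole_finite: "\<exists>x\<in>cusp_domain. log_pole x \<noteq> \<infinity>"
proof -
  define p :: "complex^2" where "p = axis 1 (1/4)"
  have p: "p $ 1 = 1/4" "p $ 2 = 0" by (simp_all add: p_def axis_def)
  have "(1/4)\<^sup>2 * (1 + exp 1) < (1::real)"
    using exp_le by (simp add: power2_eq_square)
  then have "p \<in> cusp_domain" by (simp add: cusp_domain_def poisson_pot_def cayley_def p)
  then show ?thesis by (intro bexI[of _ p]) (auto simp: log_pole_simps p)
qed

lemma psh_on_poisson_pot: "psh_on cusp_domain (\<lambda>x. ereal (poisson_pot x))"
  unfolding poisson_pot_def by (rule psh_on_Re_holomorphic[OF continuous_on_cayley_cusp cayley_along_lines])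

lemma tame_poisson_pot: "tame cusp_domain poisson_pot"
  unfolding tame_def
proof (intro conjI ballI psh_on_poisson_pot exI[of _ "\<lambda>t. t\<^sup>2"] exI[of _ log_pole] psuperh_on_log_pole
    log_pole_finite poisson_pot_square_le_log_pole)
  show "mono_on {0..} (\<lambda>t :: real. t\<^sup>2)" by (intro mono_onI power_mono) auto
  show "filterlim (\<lambda>t :: real. t\<^sup>2 / t) at_top at_top" by real_asymp
qed (auto intro: less_imp_le poisson_pot_pos)

lemma strong_majorant_log_pole: "strong_majorant cusp_domain poisson_pot log_pole"
  unfolding strong_majorant_def
proof (intro conjI ballI psuperh_on_log_pole log_pole_finite log_pole_pos allI impI)
  fix \<epsilon> :: real assume e: "0 < \<epsilon>"
  show "\<exists>M :: real. \<forall>z\<in>cusp_domain. ereal (poisson_pot z) \<le> ereal \<epsilon> * log_pole z + ereal M"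
  proof (intro exI ballI)
    fix z assume z: "z \<in> cusp_domain"
    show "ereal (poisson_pot z) \<le> ereal \<epsilon> * log_pole z + ereal (1 / (4 * \<epsilon>))"
    proof (cases "z $ 1 = 0")
      case True
      then show ?thesis using e by (simp add: log_pole_simps)
    next
      case False
      have "0 \<le> (2 * \<epsilon> * poisson_pot z - 1)\<^sup>2 / (4 * \<epsilon>)" using e by simp
      also have "\<dots> = \<epsilon> * (poisson_pot z)\<^sup>2 - poisson_pot z + 1 / (4 * \<epsilon>)"
        using e by (simp add: power2_eq_square field_simps)
      also have "\<dots> \<le> \<epsilon> * (- (2 * ln (cmod (z $ 1)))) - poisson_pot z + 1 / (4 * \<epsilon>)"
      proof -
        have "\<epsilon> * (poisson_pot z)\<^sup>2 \<le> \<epsilon> * (- (2 * ln (cmod (z $ 1))))"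
          using ln_cusp_domain[OF z False] e by (intro mult_left_mono) linarith+
        then show ?thesis by linarith
      qed
      finally show ?thesis using False by (simp add: log_pole_simps)
    qed
  qed
qed

section \<open>The envelopes\<close>

text \<open>
This is \<open>max (P + \<epsilon> ln |z|) 0\<close>, extended by \<open>0\<close> to \<open>z = 0\<close>, in a form that is visibly continuous across
the disc. It is bounded because \<open>P + \<epsilon> ln |z| \<le> P - \<epsilon> P\<^sup>2 / 2\<close>, and tends to \<open>P\<close> off the disc
as \<open>\<epsilon>\<close> tends to \<open>0\<close>.
\<close>
definition competitor :: "real \<Rightarrow> complex^2 \<Rightarrow> real" where
  "competitor \<epsilon> x = \<epsilon> * ln (max 1 (cmod (x $ 1) * exp (poisson_pot x / \<epsilon>)))"

lemma competitor_nonneg: "0 < \<epsilon> \<Longrightarrow> 0 \<le> competitor \<epsilon> x"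
  by (simp add: competitor_def)

lemma competitor_ge:
  assumes "0 < \<epsilon>" "x $ 1 \<noteq> 0"
  shows "poisson_pot x + \<epsilon> * ln (cmod (x $ 1)) \<le> competitor \<epsilon> x"
proof -
  have "poisson_pot x + \<epsilon> * ln (cmod (x $ 1)) = \<epsilon> * ln (cmod (x $ 1) * exp (poisson_pot x / \<epsilon>))"
    using assms by (simp add: ln_mult field_simps)
  also have "\<dots> \<le> competitor \<epsilon> x"
    unfolding competitor_def using assms by (intro mult_left_mono ln_mono) auto
  finally show ?thesis .
qed

lemma competitor_eq:
  assumes "0 < \<epsilon>" "competitor \<epsilon> x \<noteq> 0"
  shows "x $ 1 \<noteq> 0" "competitor \<epsilon> x = poisson_pot x + \<epsilon> * ln (cmod (x $ 1))"
proof -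
  have gt: "1 < cmod (x $ 1) * exp (poisson_pot x / \<epsilon>)"
    using assms by (auto simp: competitor_def max_def split: if_splits)
  then show x1: "x $ 1 \<noteq> 0" by auto
  show "competitor \<epsilon> x = poisson_pot x + \<epsilon> * ln (cmod (x $ 1))"
    using gt x1 assms by (simp add: competitor_def max_def ln_mult field_simps)
qed

lemma competitor_le_poisson_pot:
  assumes "0 < \<epsilon>" "x \<in> cusp_domain"
  shows "competitor \<epsilon> x \<le> poisson_pot x"
proof (cases "competitor \<epsilon> x = 0")
  case True then show ?thesis using poisson_pot_pos[OF assms(2)] by simp
next
  case False
  note c = competitor_eq[OF assms(1) False]
  have "ln (cmod (x $ 1)) \<le> 0"
    using ln_cusp_domain[OF assms(2) c(1)] zero_le_power2[of "poisson_pot x"] by linarith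
  then show ?thesis using c(2) assms(1) by (simp add: mult_nonneg_nonpos)
qed

lemma competitor_bounded:
  assumes "0 < \<epsilon>" "x \<in> cusp_domain"
  shows "competitor \<epsilon> x \<le> 1 / (2 * \<epsilon>)"
proof (cases "competitor \<epsilon> x = 0")
  case True then show ?thesis using assms by simp
next
  case False
  note c = competitor_eq[OF assms(1) False]
  have "ln (cmod (x $ 1)) \<le> - (poisson_pot x)\<^sup>2 / 2"
    using ln_cusp_domain[OF assms(2) c(1)] by linarith
  then have "competitor \<epsilon> x \<le> poisson_pot x + \<epsilon> * (- (poisson_pot x)\<^sup>2 / 2)"
    unfolding c(2) using assms(1) by (intro add_left_mono mult_left_mono) auto
  \<comment> \<open>Completing the square.\<close>
  also have "\<dots> = 1 / (2 * \<epsilon>) - (\<epsilon> * poisson_pot x - 1)\<^sup>2 / (2 * \<epsilon>)"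
    using assms(1) by (simp add: power2_eq_square field_simps)
  also have "\<dots> \<le> 1 / (2 * \<epsilon>)" using assms(1) by simp
  finally show ?thesis .
qed

lemma psh_on_competitor:
  assumes e: "0 < \<epsilon>"
  shows "psh_on cusp_domain (\<lambda>x. ereal (competitor \<epsilon> x))"
proof (rule psh_on_supremum)
  show "continuous_on cusp_domain (competitor \<epsilon>)"
    unfolding competitor_def[abs_def] using e by (intro continuous_intros continuous_on_poisson_pot_cusp) auto
  fix x and d :: real assume x: "x \<in> cusp_domain" and d: "0 < d"
  show "\<exists>v. psh_on cusp_domain v \<and> (\<forall>y\<in>cusp_domain. v y \<le> ereal (competitor \<epsilon> y)) \<and>
      ereal (competitor \<epsilon> x - d) \<le> v x"
  proof (cases "competitor \<epsilon> x = 0")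
    case True
    then show ?thesis using d competitor_nonneg[OF e]
      by (intro exI[of _ "\<lambda>_. ereal 0"] conjI psh_on_const) auto
  next
    case False
    note c = competitor_eq[OF e False]
    have "psh_on cusp_domain (re_plus_log (\<lambda>x. cayley (x $ 2)) \<epsilon> 1)"
      by (rule psh_on_re_plus_log[OF continuous_on_cayley_cusp cayley_along_lines e])
    moreover have "re_plus_log (\<lambda>x. cayley (x $ 2)) \<epsilon> 1 y \<le> ereal (competitor \<epsilon> y)" for y
      using competitor_ge[OF e, of y] by (simp add: re_plus_log_def poisson_pot_def)
    moreover have "ereal (competitor \<epsilon> x - d) \<le> re_plus_log (\<lambda>x. cayley (x $ 2)) \<epsilon> 1 x"
      using c d by (simp add: re_plus_log_def poisson_pot_def)
    ultimately show ?thesis by blast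
  qed
qed

text \<open>
The disc is the slice of the domain by a full complex line. There \<open>u\<close> is a subharmonic function bounded
above and below the Poisson kernel.
\<close>
lemma psh_nonpos_on_cusp_disc:
  assumes u: "psh_on cusp_domain u" and uW: "\<And>x. x \<in> cusp_domain \<Longrightarrow> u x \<le> ereal (poisson_pot x)"
    and bdd: "(SUP x\<in>cusp_domain. u x) < \<infinity>" and z: "z \<in> cusp_disc"
  shows "u z \<le> 0"
proof -
  define e :: "complex^2" where "e = axis 2 1"
  have le: "(0 + l *s e) $ 1 = 0" "(0 + l *s e) $ 2 = l" for l
    by (simp_all add: e_def axis_def)
  have in_disc: "0 + l *s e \<in> cusp_disc \<longleftrightarrow> l \<in> ball 0 1" for l
    unfolding cusp_disc_def mem_Collect_eq le by simp
  have in_dom: "0 + l *s e \<in> cusp_domain \<longleftrightarrow> l \<in> ball 0 1" for l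
    using in_disc[of l] cusp_disc_subset cusp_domain_cylinder[of "0 + l *s e"] unfolding le by auto
  have "subharmonic_on {l. 0 + l *s e \<in> cusp_domain} (\<lambda>l. u (0 + l *s e))"
    using u unfolding psh_on_def by blast
  then have sub: "subharmonic_on (ball 0 1) (\<lambda>l. u (0 + l *s e))"
    unfolding in_dom Collect_mem_eq .
  obtain M :: real where M: "(SUP x\<in>cusp_domain. u x) \<le> ereal M"
    using bdd by (cases "SUP x\<in>cusp_domain. u x") auto
  have zeq: "z = 0 + z $ 2 *s e"
    using z by (simp add: vec_eq_iff forall_2 e_def axis_def cusp_disc_def)
  have "u (0 + z $ 2 *s e) \<le> 0"
  proof (rule subharmonic_below_poisson_kernel_nonpos[OF sub, of M])
    fix l :: complex assume "l \<in> ball 0 1"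
    then have l: "0 + l *s e \<in> cusp_domain" by (simp only: in_dom)
    show "u (0 + l *s e) \<le> ereal M" using SUP_upper[OF l, of u] M by (rule order_trans)
    show "u (0 + l *s e) \<le> ereal (Re (cayley l))" using uW[OF l] unfolding poisson_pot_def le .
  qed (use z in \<open>simp add: cusp_disc_def\<close>)
  then show ?thesis using zeq by simp
qed

lemma envelope_bounded_le_above: "envelope_bounded \<Omega> w z \<le> envelope_above \<Omega> w z"
  unfolding envelope_bounded_def envelope_above_def by (rule SUP_subset_mono) auto

lemma envelope_bounded_ge_competitor:
  assumes "0 < \<epsilon>"
  shows "ereal (competitor \<epsilon> z) \<le> envelope_bounded cusp_domain poisson_pot z"
  unfolding envelope_bounded_def
proof (rule SUP_upper[of "\<lambda>x. ereal (competitor \<epsilon> x)"], intro CollectI conjI ballI)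
  show "psh_on cusp_domain (\<lambda>x. ereal (competitor \<epsilon> x))" by (rule psh_on_competitor[OF assms])
  show "ereal (competitor \<epsilon> x) \<le> ereal (poisson_pot x)" if "x \<in> cusp_domain" for x
    using competitor_le_poisson_pot[OF assms that] by simp
  have "(SUP x\<in>cusp_domain. ereal (competitor \<epsilon> x)) \<le> ereal (1 / (2 * \<epsilon>))"
    using competitor_bounded[OF assms] by (intro SUP_least) simp
  then show "(SUP x\<in>cusp_domain. ereal (competitor \<epsilon> x)) < \<infinity>"
    by (rule order_le_less_trans) simp
  have "ereal 0 \<le> (INF x\<in>cusp_domain. ereal (competitor \<epsilon> x))"
    using competitor_nonneg[OF assms] by (intro INF_greatest) simp
  then show "- \<infinity> < (INF x\<in>cusp_domain. ereal (competitor \<epsilon> x))"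
    by (rule order_less_le_trans[rotated]) simp
qed

text \<open>
The values of both envelopes at once: each lies between the envelope over bounded functions, which
the competitors bound from below, and the envelope over functions bounded above, which the
Poisson kernel bounds from above everywhere and \<open>0\<close> on the disc.
\<close>
lemma envelope_values:
  assumes V: "V \<in> {envelope_above cusp_domain poisson_pot, envelope_bounded cusp_domain poisson_pot}"
  shows envelope_le_poisson_pot: "z \<in> cusp_domain \<Longrightarrow> V z \<le> ereal (poisson_pot z)"
    and envelope_off_disc: "z \<in> cusp_domain \<Longrightarrow> z $ 1 \<noteq> 0 \<Longrightarrow> V z = ereal (poisson_pot z)"
    and envelope_on_disc: "z \<in> cusp_disc \<Longrightarrow> V z = 0"
proof -
  have ge: "envelope_bounded cusp_domain poisson_pot z \<le> V z"
    and le: "V z \<le> envelope_above cusp_domain poisson_pot z" for z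
    using V envelope_bounded_le_above by auto
  show leW: "V z \<le> ereal (poisson_pot z)" if "z \<in> cusp_domain" for z
  proof (rule order_trans[OF le])
    show "envelope_above cusp_domain poisson_pot z \<le> ereal (poisson_pot z)"
      unfolding envelope_above_def using that by (intro SUP_least) blast
  qed
  show "V z = ereal (poisson_pot z)" if z: "z \<in> cusp_domain" and z1: "z $ 1 \<noteq> 0" for z
  proof (rule antisym[OF leW[OF z]])
    define L where "L = - ln (cmod (z $ 1))"
    have L: "0 < L"
      using ln_cusp_domain[OF z z1] zero_le_power2[of "poisson_pot z"] unfolding L_def by linarith
    show "ereal (poisson_pot z) \<le> V z"
    \<comment> \<open>The parameter \<open>e / L\<close> of the competitor makes the loss \<open>\<epsilon> ln |z|\<close> at \<open>z\<close> equal to \<open>e\<close>.\<close>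
    proof (rule ereal_le_epsilon2)
      fix e :: real assume e: "0 < e"
      have "poisson_pot z - e \<le> competitor (e / L) z"
      proof -
        have "ln (cmod (z $ 1)) = - L" by (simp add: L_def)
        then show ?thesis using competitor_ge[of "e / L" z] z1 e L by simp
      qed
      then have "ereal (poisson_pot z) \<le> ereal (competitor (e / L) z) + ereal e" by simp
      also have "ereal (competitor (e / L) z) \<le> V z"
        using envelope_bounded_ge_competitor[of "e / L" z] ge[of z] e L by (auto intro: order_trans)
      finally show "ereal (poisson_pot z) \<le> V z + ereal e" by (simp add: add_right_mono)
    qed
  qed
  show "V z = 0" if z: "z \<in> cusp_disc" for z
  proof (rule antisym)
    show "V z \<le> 0"
    proof (rule order_trans[OF le])
      show "envelope_above cusp_domain poisson_pot z \<le> 0"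
        unfolding envelope_above_def using psh_nonpos_on_cusp_disc[OF _ _ _ z]
        by (intro SUP_least) blast
    qed
    have "ereal 0 \<le> ereal (competitor 1 z)" using competitor_nonneg[of 1 z] by simp
    also have "\<dots> \<le> V z"
      using envelope_bounded_ge_competitor[of 1 z] ge[of z] by (auto intro: order_trans)
    finally show "0 \<le> V z" by (simp add: zero_ereal_def)
  qed
qed

lemma ex_off_disc_in_open:
  fixes U :: "(complex^2) set"
  assumes "open U" "z \<in> U"
  shows "\<exists>x\<in>U. x $ 1 \<noteq> 0 \<and> x $ 2 = z $ 2"
proof (cases "z $ 1 = 0")
  case True
  obtain e where e: "0 < e" "ball z e \<subseteq> U" using assms open_contains_ball by blast
  define x where "x = z + axis 1 (of_real (e / 2))"
  have x: "x $ 1 \<noteq> 0" "x $ 2 = z $ 2" using True e by (simp_all add: x_def axis_def)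
  have "x \<in> ball z e" using e 

    unfolding x_def mem_ball dist_norm
    by (simp add: norm_eq_sqrt_inner inner_axis_axis inner_complex_def power2_eq_square[symmetric])
  then show ?thesis using x e by blast
qed (use assms in auto)

lemma not_usc_on_envelope:
  assumes V: "V \<in> {envelope_above cusp_domain poisson_pot, envelope_bounded cusp_domain poisson_pot}"
  shows "\<not> usc_on cusp_domain V"
proof
  assume "usc_on cusp_domain V"
  then have "openin (top_of_set cusp_domain) {z \<in> cusp_domain. V z < ereal 1}"
    by (simp add: usc_on_def)
  then have op: "open {z \<in> cusp_domain. V z < ereal 1}"
    using open_cusp_domain openin_open_trans by blast
  have "(0 :: complex^2) \<in> cusp_disc" by (simp add: cusp_disc_def)
  then have "0 \<in> {z \<in> cusp_domain. V z < ereal 1}"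
    using envelope_on_disc[OF V] cusp_disc_subset by auto
  from ex_off_disc_in_open[OF op this]
  obtain x where x: "x \<in> cusp_domain" "V x < ereal 1" "x $ 1 \<noteq> 0" "x $ 2 = 0" by auto
  have "V x = ereal 1"
    using envelope_off_disc[OF V x(1,3)] x(4) by (simp add: poisson_pot_def cayley_def)
  with x(2) show False by simp
qed

lemma usc_reg_envelope:
  assumes V: "V \<in> {envelope_above cusp_domain poisson_pot, envelope_bounded cusp_domain poisson_pot}"
    and z: "z \<in> cusp_domain"
  shows "usc_reg cusp_domain V z = ereal (poisson_pot z)"
  unfolding usc_reg_def
proof (rule antisym)
  let ?F = "inf (nhds z) (principal cusp_domain)"
  have nz: "\<forall>\<^sub>F x in nhds z. x \<in> cusp_domain"
    using open_cusp_domain z by (rule eventually_nhds_in_open)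
  have F: "?F = nhds z"
    using nz by (simp add: inf_absorb1 le_principal)
  have "isCont poisson_pot z"
    using continuous_on_poisson_pot_cusp open_cusp_domain z by (simp add: continuous_on_eq_continuous_at)
  then have WF: "((\<lambda>x. ereal (poisson_pot x)) \<longlongrightarrow> ereal (poisson_pot z)) (nhds z)"
    by (intro tendsto_intros) (simp add: isCont_def tendsto_at_iff_tendsto_nhds)
  have "\<forall>\<^sub>F x in nhds z. V x \<le> ereal (poisson_pot x)"
    using nz by eventually_elim (rule envelope_le_poisson_pot[OF V])
  then have "Limsup (nhds z) V \<le> Limsup (nhds z) (\<lambda>x. ereal (poisson_pot x))"
    by (rule Limsup_mono)
  also have "\<dots> = ereal (poisson_pot z)" by (rule lim_imp_Limsup[OF _ WF]) simp
  finally show "Limsup ?F V \<le> ereal (poisson_pot z)" unfolding F .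
  show "ereal (poisson_pot z) \<le> Limsup ?F V"
    unfolding F
  proof (rule ccontr)
    assume "\<not> ereal (poisson_pot z) \<le> Limsup (nhds z) V"
    then obtain y where y: "Limsup (nhds z) V < y" "y < ereal (poisson_pot z)"
      using dense[of "Limsup (nhds z) V" "ereal (poisson_pot z)"] by (auto simp: not_le)
    have "\<forall>\<^sub>F x in nhds z. V x < y" by (rule Limsup_lessD[OF y(1)])
    moreover have "\<forall>\<^sub>F x in nhds z. y < ereal (poisson_pot x)" by (rule order_tendstoD(1)[OF WF y(2)])
    ultimately have "\<forall>\<^sub>F x in nhds z. V x < y \<and> y < ereal (poisson_pot x) \<and> x \<in> cusp_domain"
      using nz by eventually_elim simp
    then obtain U where U: "open U" "z \<in> U"
      "\<And>x. x \<in> U \<Longrightarrow> V x < y \<and> y < ereal (poisson_pot x) \<and> x \<in> cusp_domain"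
      unfolding eventually_nhds by blast
    obtain x where x: "x \<in> U" "x $ 1 \<noteq> 0" using ex_off_disc_in_open[OF U(1,2)] by blast
    then have "V x = ereal (poisson_pot x)" using U(3)[of x] envelope_off_disc[OF V, of x] by blast
    then show False using U(3)[OF x(1)] by (metis less_asym)
  qed
qed

lemma analytic_disc_cusp_disc: "analytic_disc cusp_disc"
  unfolding analytic_disc_def
proof (intro exI conjI allI)
  let ?h = "\<lambda>l :: complex. axis 2 l :: complex^2"
  show "(\<lambda>l. ?h l $ i) holomorphic_on ball 0 1" for i
    by (cases "i = 2") (auto simp: axis_def)
  have "(0::complex) \<in> ball 0 1" "(1/2::complex) \<in> ball 0 1" "?h 0 \<noteq> ?h (1/2)"
    by (simp_all add: axis_eq_axis)
  then show "\<not> ?h constant_on ball 0 1" unfolding constant_on_def by metis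
  show "cusp_disc = ?h ` ball 0 1"
  proof (intro equalityI subsetI)
    fix x assume "x \<in> cusp_disc"
    then have "x = ?h (x $ 2)" "x $ 2 \<in> ball 0 1"
      by (simp_all add: cusp_disc_def vec_eq_iff forall_2 axis_def)
    then show "x \<in> ?h ` ball 0 1" by blast
  qed (auto simp: cusp_disc_def axis_def)
qed

lemma unbounded_poisson_pot: "\<not> bounded (poisson_pot ` cusp_domain)"
proof
  assume "bounded (poisson_pot ` cusp_domain)"
  then obtain B where B: "\<And>x. x \<in> cusp_domain \<Longrightarrow> \<bar>poisson_pot x\<bar> \<le> B"
    by (auto simp: bounded_iff)
  define t where "t = 1 - 1 / (\<bar>B\<bar> + 1)"
  have t: "0 \<le> t" "t < 1" by (simp_all add: t_def field_simps)
  define x :: "complex^2" where "x = axis 2 (of_real t)"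
  have x: "x $ 1 = 0" "x $ 2 = of_real t" by (simp_all add: x_def axis_def)
  have "x \<in> cusp_disc" using t by (simp add: cusp_disc_def x)
  then have "\<bar>poisson_pot x\<bar> \<le> B" using B cusp_disc_subset by blast
  moreover have "cayley (of_real t) = of_real ((1 + t) / (1 - t))" by (simp add: cayley_def)
  then have "poisson_pot x = (1 + t) / (1 - t)" by (simp add: poisson_pot_def x)
  moreover have "(1 + t) / (1 - t) = (1 + t) * (\<bar>B\<bar> + 1)" by (simp add: t_def)
  moreover have "1 * (\<bar>B\<bar> + 1) \<le> (1 + t) * (\<bar>B\<bar> + 1)" using t by (intro mult_right_mono) auto
  ultimately have "\<bar>B\<bar> + 1 \<le> poisson_pot x" "\<bar>poisson_pot x\<bar> \<le> B" by simp_all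
  then show False by linarith
qed

theorem theorem1p2:
  shows "\<exists>(\<Omega> :: (complex^2) set) (W :: complex^2 \<Rightarrow> real) (H :: (complex^2) set).
    B_regular \<Omega> \<and>
    (\<forall>z\<in>\<Omega>. 0 < W z) \<and> continuous_on \<Omega> W \<and> \<not> bounded (W ` \<Omega>) \<and>
    tame \<Omega> W \<and> pluriharmonic_on \<Omega> W \<and>
    analytic_disc H \<and> H \<subseteq> \<Omega> \<and>
    (\<forall>V \<in> {envelope_above \<Omega> W, envelope_bounded \<Omega> W}.
       \<not> usc_on \<Omega> V \<and>
       (\<forall>z\<in>\<Omega> - H. V z = ereal (W z)) \<and>
       (\<forall>z\<in>H. V z = 0 \<and> 0 < W z) \<and>
       (\<forall>z\<in>\<Omega>. usc_reg \<Omega> V z = ereal (W z))) \<and>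
    pluri_quasibounded \<Omega> W"
proof (rule exI[of _ cusp_domain], rule exI[of _ poisson_pot], rule exI[of _ cusp_disc], intro conjI ballI)
  show "pluriharmonic_on cusp_domain poisson_pot"
    unfolding poisson_pot_def[abs_def]
    by (rule pluriharmonic_on_Re_coordinate[OF holomorphic_cayley]) (auto simp: cusp_domain_cylinder)
  show "pluri_quasibounded cusp_domain poisson_pot"
    unfolding pluri_quasibounded_def using strong_majorant_log_pole by blast
  fix V z assume V: "V \<in> {envelope_above cusp_domain poisson_pot, envelope_bounded cusp_domain poisson_pot}"
  show "V z = ereal (poisson_pot z)" if "z \<in> cusp_domain - cusp_disc"
    using that by (intro envelope_off_disc[OF V]) (auto simp: cusp_disc_def dest: cusp_domain_cylinder)
  show "V z = 0" if "z \<in> cusp_disc" using that by (rule envelope_on_disc[OF V])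
  show "usc_reg cusp_domain V z = ereal (poisson_pot z)" if "z \<in> cusp_domain"
    using that by (rule usc_reg_envelope[OF V])
  show "\<not> usc_on cusp_domain V" by (rule not_usc_on_envelope[OF V])
  show "0 < poisson_pot z" if "z \<in> cusp_disc" using that cusp_disc_subset by (blast intro: poisson_pot_pos)
qed (rule B_regular_cusp_domain poisson_pot_pos continuous_on_poisson_pot_cusp unbounded_poisson_pot tame_poisson_pot
    analytic_disc_cusp_disc cusp_disc_subset; assumption?)+

end
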